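(* The members of the infinite family $\{H_k\}_{k\ge 1}$ of plane graphs can take the place of $H=H_1$ in the counterexample $G$ described in the context, in the sense that each $H_k$ has the property used there: every proper vertex coloring of $H_k$ by colors $\{1,2,3,4\}$ in which every interior face has a unique-maximum color has a vertex in the outer face colored by $4$. This gives an infinite family of plane graphs with $\chi_{\mathrm{fum}}>4$, that is, an infinite family of counterexamples to the conjecture that $\chi_{\mathrm{fum}}(G)\le 4$ for every plane graph $G$.
   Context: A plane graph is a graph embedded in the plane without crossing edges. A coloring of a graph assigns colors to its vertices, and it is proper if adjacent vertices receive distinct colors. A face has a unique-maximum color if the maximal color appearing on its vertices appears on exactly one of its vertices. A facial unique-maximum coloring (FUM-coloring) of a plane graph is a proper vertex coloring by natural numbers in which every face, including the outer face, has a unique-maximum color. The facial unique-maximum chromatic number $\chi_{\mathrm{fum}}(G)$ is the minimum $m$ such that $G$ has a FUM-coloring using the colors $\{1,2,\ldots,m\}$. For $k\ge 1$, the plane graph $H_k$ on $6k+2$ vertices is constructed by first embedding the cycle $b_1b_2\cdots b_{3k+1}$ inside the cycle $a_1a_2\cdots a_{3k+1}$. For $1\le i\le 3k$, the edges $a_ib_i$ and $b_ia_{i+1}$ are added, and then the edges $a_{3k+1}b_{3k+1}$ and $b_{3k+1}a_1$. The added edges lie without crossings between the two cycles, so the outer face of $H_k$ is bounded by the cycle $a_1a_2\cdots a_{3k+1}$. The interior faces are all the other faces. The counterexample $G$ with $\chi_{\mathrm{fum}}(G)>4$ consists of $H=H_1$, an isomorphic copy $H'$ of $H$, and the edge $a_4a_2'$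 connecting them, where $a_2'$ is the copy of $a_2$ in $H'$. The two copies lie in each other's outer faces, so the vertices $a_i$ and $a_i'$ are all on the outer face of $G$. In a FUM-coloring of $G$ with colors $\{1,2,3,4\}$, at most one vertex of the outer face could have color $4$, so one of the copies would have no vertex of color $4$ on its outer cycle. This contradicts the property above for $H$. *)

theory Defs
  imports "HOL-Analysis.Analysis"
begin

section \<open>Plane graphs and their faces\<close>

text \<open>
  A plane graph is a finite simple graph drawn in the plane: the vertices are points, the edges
  are arcs (as point sets), and the relative interior of an edge contains no vertex and no point
  of another edge. Graphs have at least one vertex.
\<close>

record plane_drawing =
  verts :: "complex set"
  edges :: "complex set set"

definition arc_between :: "complex set \<Rightarrow> complex \<Rightarrow> complex \<Rightarrow> bool" where
  "arc_between e u v \<longleftrightarrow> (\<exists>g. arc g \<and> path_image g = e \<and> pathstart g = u \<and> pathfinish g = v)"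

text \<open>
  Since an edge meets the vertex set only in its two ends, the last two conditions say that two
  edges meet only in common ends, and that there are no parallel edges.
  Loops are impossible because the ends of an arc are distinct.
\<close>

definition plane_graph :: "plane_drawing \<Rightarrow> bool" where
  "plane_graph G \<longleftrightarrow>
     finite (verts G) \<and> verts G \<noteq> {} \<and> finite (edges G) \<and>
     (\<forall>e\<in>edges G. \<exists>u v. arc_between e u v \<and> e \<inter> verts G = {u, v}) \<and>
     (\<forall>e\<in>edges G. \<forall>e'\<in>edges G. e \<noteq> e' \<longrightarrow> e \<inter> e' \<subseteq> verts G) \<and>
     (\<forall>e\<in>edges G. \<forall>e'\<in>edges G. e \<noteq> e' \<longrightarrow> e \<inter> verts G \<noteq> e' \<inter> verts G)"

definition adjacent :: "plane_drawing \<Rightarrow> complex \<Rightarrow> complex \<Rightarrow> bool" where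
  "adjacent G u v \<longleftrightarrow> (\<exists>e\<in>edges G. arc_between e u v)"

definition point_set :: "plane_drawing \<Rightarrow> complex set" where
  "point_set G = verts G \<union> \<Union> (edges G)"

definition faces :: "plane_drawing \<Rightarrow> complex set set" where
  "faces G = components (- point_set G)"

definition outer_face :: "plane_drawing \<Rightarrow> complex set" where
  "outer_face G = (THE F. F \<in> faces G \<and> \<not> bounded F)"

definition interior_faces :: "plane_drawing \<Rightarrow> complex set set" where
  "interior_faces G = faces G - {outer_face G}"

definition face_verts :: "plane_drawing \<Rightarrow> complex set \<Rightarrow> complex set" where
  "face_verts G F = verts G \<inter> frontier F"

definition isomorphic_graphs :: "plane_drawing \<Rightarrow> plane_drawing \<Rightarrow> bool" where
  "isomorphic_graphs G G' \<longleftrightarrow>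
     (\<exists>\<phi>. bij_betw \<phi> (verts G) (verts G') \<and>
          (\<forall>u\<in>verts G. \<forall>v\<in>verts G. adjacent G u v \<longleftrightarrow> adjacent G' (\<phi> u) (\<phi> v)))"


section \<open>Facial unique-maximum colorings\<close>

definition proper_coloring :: "plane_drawing \<Rightarrow> (complex \<Rightarrow> nat) \<Rightarrow> bool" where
  "proper_coloring G c \<longleftrightarrow> (\<forall>u\<in>verts G. \<forall>v\<in>verts G. adjacent G u v \<longrightarrow> c u \<noteq> c v)"

definition unique_max_color :: "plane_drawing \<Rightarrow> (complex \<Rightarrow> nat) \<Rightarrow> complex set \<Rightarrow> bool" where
  "unique_max_color G c F \<longleftrightarrow>
     (\<exists>!v. v \<in> face_verts G F \<and> c v = Max (c ` face_verts G F))"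

definition fum_coloring :: "plane_drawing \<Rightarrow> (complex \<Rightarrow> nat) \<Rightarrow> bool" where
  "fum_coloring G c \<longleftrightarrow> proper_coloring G c \<and> (\<forall>F\<in>faces G. unique_max_color G c F)"

definition chi_fum :: "plane_drawing \<Rightarrow> nat" where
  "chi_fum G = (LEAST m. \<exists>c. fum_coloring G c \<and> c ` verts G \<subseteq> {1..m})"


section \<open>The graphs \<open>H\<^sub>k\<close> and the graphs built from two copies of them\<close>

text \<open>Cyclic successor on the indices \<open>1, \<dots>, 3k+1\<close>.\<close>

definition nxt :: "nat \<Rightarrow> nat \<Rightarrow> nat" where
  "nxt k i = (if i = 3 * k + 1 then 1 else i + 1)"

text \<open>
  \<open>H_labelled k a b H\<close>: the plane graph \<open>H\<close> is a drawing of \<open>H\<^sub>k\<close> with vertices \<open>a\<^sub>i\<close>, \<open>b\<^sub>i\<close>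
  (\<open>1 \<le> i \<le> 3k+1\<close>). Here \<open>ea i\<close>, \<open>eb i\<close> are the edges of the two cycles, and \<open>ep i\<close>, \<open>eq i\<close>
  are the added edges \<open>a\<^sub>i b\<^sub>i\<close> and \<open>b\<^sub>i a\<^bsub>i+1\<^esub>\<close>. The last three conditions fix the embedding:
  the cycle of the \<open>b\<^sub>i\<close> is inside the cycle of the \<open>a\<^sub>i\<close>, and the added edges run between them.
\<close>

definition H_labelled ::
  "nat \<Rightarrow> (nat \<Rightarrow> complex) \<Rightarrow> (nat \<Rightarrow> complex) \<Rightarrow> plane_drawing \<Rightarrow> bool" where
  "H_labelled k a b H \<longleftrightarrow>
     (let I = {1..3 * k + 1} in
       plane_graph H \<and>
       inj_on a I \<and> inj_on b I \<and> a ` I \<inter> b ` I = {} \<and> verts H = a ` I \<union> b ` I \<and>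
       (\<exists>ea eb ep eq.
          edges H = ea ` I \<union> eb ` I \<union> ep ` I \<union> eq ` I \<and>
          (\<forall>i\<in>I. arc_between (ea i) (a i) (a (nxt k i)) \<and>
                 arc_between (eb i) (b i) (b (nxt k i)) \<and>
                 arc_between (ep i) (a i) (b i) \<and>
                 arc_between (eq i) (b i) (a (nxt k i))) \<and>
          (\<Union>i\<in>I. eb i) \<subseteq> inside (\<Union>i\<in>I. ea i) \<and>
          (\<forall>i\<in>I. ep i - {a i, b i} \<subseteq> inside (\<Union>i\<in>I. ea i) \<inter> outside (\<Union>i\<in>I. eb i)) \<and>
          (\<forall>i\<in>I. eq i - {b i, a (nxt k i)} \<subseteq> inside (\<Union>i\<in>I. ea i) \<inter> outside (\<Union>i\<in>I. eb i))))"

definition H_graph :: "nat \<Rightarrow> plane_drawing \<Rightarrow> bool" where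
  "H_graph k H \<longleftrightarrow> (\<exists>a b. H_labelled k a b H)"

text \<open>
  \<open>G_graph k G\<close>: the plane graph \<open>G\<close> consists of two copies of \<open>H\<^sub>k\<close>, lying in each other's outer
  faces, and an edge from \<open>a\<^sub>4\<close> in the first copy to \<open>a\<^sub>2\<close> in the second.
\<close>

definition G_graph :: "nat \<Rightarrow> plane_drawing \<Rightarrow> bool" where
  "G_graph k G \<longleftrightarrow> plane_graph G \<and>
     (\<exists>H H' a b a' b' e.
        H_labelled k a b H \<and> H_labelled k a' b' H' \<and>
        point_set H \<subseteq> outer_face H' \<and> point_set H' \<subseteq> outer_face H \<and>
        arc_between e (a 4) (a' 2) \<and>
        verts G = verts H \<union> verts H' \<and>
        edges G = insert e (edges H \<union> edges H'))"

end

theory Submission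
  imports Defs
begin

text \<open>
  The triangular faces of \<open>H\<^sub>k\<close> impose nothing beyond properness, so the only interior face that
  matters is the inside of the cycle of the \<open>b\<^sub>i\<close>. If no \<open>a\<^sub>i\<close> has color 4, then at most one \<open>b\<^sub>j\<close> has
  color 4, and the remaining strip of triangles from \<open>a\<^bsub>j+1\<^esub>\<close> to \<open>a\<^sub>j\<close> is 3-colored, which forces period 3
  along the strip; since it has \<open>6k + 1\<close> vertices, the adjacent vertices \<open>a\<^bsub>j+1\<^esub>\<close> and \<open>a\<^sub>j\<close> get equal
  colors. For the joined graph, Janiszewski's theorem shows that the complement of the two closed
  discs and the joining arc is connected; it is the outer face and has both outer cycles on its
  frontier, so it contains two vertices of color 4.

  Since \<open>chi_fum\<close> is a \<open>LEAST\<close>, the bound \<open>chi_fum G > 4\<close> also needs some FUM-coloring to exist.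
  Injective colorings are FUM-colorings once every face has a vertex on its frontier.
\<close>

section \<open>Arcs in the plane and incidences in plane graphs\<close>

lemma arc_between_ends: "arc_between e u v \<Longrightarrow> u \<in> e \<and> v \<in> e \<and> u \<noteq> v"
  unfolding arc_between_def
  using arc_distinct_ends pathfinish_in_path_image pathstart_in_path_image by metis

lemma arc_between_connected_compact: "arc_between e u v \<Longrightarrow> connected e \<and> compact e"
  unfolding arc_between_def using connected_arc_image compact_arc_image by blast

lemma arc_between_complement_connected: "arc_between e u v \<Longrightarrow> connected (- e)"
  unfolding arc_between_def using connected_arc_complement[where 'a = complex] by auto

text \<open>Invariance of dimension: the inverse of the parametrization would embed a nonempty open
  subset of the plane into the line.\<close>

lemma arc_between_interior_empty:
  assumes "arc_between e u v"
  shows "interior e = {}"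
proof (rule ccontr)
  assume ne: "interior e \<noteq> {}"
  obtain g where g: "arc g" "path_image g = e"
    using assms unfolding arc_between_def by blast
  obtain h where h: "homeomorphism {0..1} (path_image g) g h"
    using homeomorphism_arc[OF g(1)] .
  have inj: "inj_on h (path_image g)"
    using h unfolding homeomorphism_def inj_on_def by metis
  have "continuous_on (interior e) h" "inj_on h (interior e)"
    using h g(2) inj interior_subset[of e]
    unfolding homeomorphism_def by (auto intro: continuous_on_subset inj_on_subset)
  then have "DIM(complex) \<le> DIM(real)"
    using invariance_of_dimension[of "interior e" h] ne by simp
  then show False by simp
qed

text \<open>The set is the image of \<open>{0<..1}\<close> under the parametrization. It lets the
  joining edge, apart from one end, be placed in a single face of a copy.\<close>

lemma arc_between_Diff_start_connected:
  assumes "arc_between e u v"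
  shows "connected (e - {u})"
proof -
  obtain g where g: "arc g" "path_image g = e" "pathstart g = u"
    using assms unfolding arc_between_def by blast
  have "e - {u} = g ` {0<..1}"
  proof -
    have "{0..1::real} = insert 0 {0<..1}" by auto
    moreover have "g 0 \<notin> g ` {0<..1}"
      using g(1) unfolding arc_def inj_on_def by force
    ultimately show ?thesis
      using g(2,3) unfolding path_image_def pathstart_def by force
  qed
  moreover have "continuous_on {0<..1} g"
    using g(1) unfolding arc_def path_def by (auto intro: continuous_on_subset)
  ultimately show ?thesis
    using connected_continuous_image[of "{0<..1}" g] by simp
qed

lemma plane_graphD:
  assumes "plane_graph G"
  shows "finite (verts G)" "verts G \<noteq> {}" "finite (edges G)"
    "\<And>e. e \<in> edges G \<Longrightarrow> \<exists>u v. arc_between e u v \<and> e \<inter> verts G = {u, v}"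
    "\<And>e e'. e \<in> edges G \<Longrightarrow> e' \<in> edges G \<Longrightarrow> e \<noteq> e' \<Longrightarrow> e \<inter> e' \<subseteq> verts G"
    "\<And>e e'. e \<in> edges G \<Longrightarrow> e' \<in> edges G \<Longrightarrow> e \<noteq> e' \<Longrightarrow> e \<inter> verts G \<noteq> e' \<inter> verts G"
  using assms unfolding plane_graph_def by simp_all

text \<open>The definition of \<open>plane_graph\<close> yields some pair of ends. As
  \<open>e\<close> contains only two vertices, any two distinct vertices it joins are that
  pair.\<close>

lemma plane_graph_edge_ends:
  assumes "plane_graph G" "e \<in> edges G" "arc_between e u v" "u \<in> verts G" "v \<in> verts G"
  shows "e \<inter> verts G = {u, v}"
proof -
  obtain u' v' where uv': "e \<inter> verts G = {u', v'}"
    using plane_graphD(4)[OF assms(1,2)] by blast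
  have "u \<noteq> v" "u \<in> {u', v'}" "v \<in> {u', v'}"
    using arc_between_ends[OF assms(3)] assms(4,5) by (auto simp flip: uv')
  then show ?thesis
    using uv' by auto
qed

lemma plane_graph_point_set_compact:
  assumes "plane_graph G"
  shows "compact (point_set G)"
  unfolding point_set_def
proof (intro compact_Un compact_Union)
  show "compact (verts G)"
    using plane_graphD(1)[OF assms] by (rule finite_imp_compact)
  show "compact e" if "e \<in> edges G" for e
    using plane_graphD(4)[OF assms that] arc_between_connected_compact by metis
qed (rule plane_graphD(3)[OF assms])

section \<open>Faces\<close>

text \<open>A connected set properly containing \<open>F\<close> meets \<open>frontier F\<close>,
  hence leaves the complement of \<open>P\<close>. All explicit faces are identified through this
  criterion.\<close>

lemma component_of_frontier_subset:
  fixes F :: "'a::topological_space set"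
  assumes "connected F" "F \<noteq> {}" "F \<inter> P = {}" "frontier F \<subseteq> P"
  shows "F \<in> components (- P)"
  unfolding in_components_maximal
proof (intro conjI allI impI)
  fix D assume D: "D \<noteq> {} \<and> F \<subseteq> D \<and> D \<subseteq> - P \<and> connected D"
  show "D = F"
  proof (rule ccontr)
    assume "D \<noteq> F"
    then have "D \<inter> frontier F \<noteq> {}"
      using D assms(2) by (intro connected_Int_frontier) auto
    then show False using D assms(4) by blast
  qed
qed (use assms in auto)

text \<open>In the plane the complement of a bounded set has only one unbounded component, which
  makes the \<open>THE\<close> in \<open>outer_face\<close> meaningful.\<close>

lemma outer_face_eqI:
  assumes "bounded (point_set G)" "F \<in> faces G" "\<not> bounded F"
  shows "outer_face G = F"
  unfolding outer_face_def
proof (rule the_equality)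
  fix F' assume "F' \<in> faces G \<and> \<not> bounded F'"
  then show "F' = F"
    using assms cobounded_unique_unbounded_components[of "- point_set G" F' F]
    unfolding faces_def by auto
qed (use assms in auto)

text \<open>Janiszewski's theorem is applied to one compact set at a time; the required
  connectedness of the intersection is trivial, since it is empty.\<close>

lemma disjoint_compacts_complement_connected:
  fixes K :: "'i \<Rightarrow> complex set"
  assumes "finite E" "\<And>e. e \<in> E \<Longrightarrow> compact (K e) \<and> connected (- K e)"
    "\<And>e e'. e \<in> E \<Longrightarrow> e' \<in> E \<Longrightarrow> e \<noteq> e' \<Longrightarrow> K e \<inter> K e' = {}"
  shows "connected (- (\<Union>e\<in>E. K e))"
  using assms
proof (induction E rule: finite_induct)
  case (insert x E)
  have "connected (- (K x \<union> (\<Union>e\<in>E. K e)))"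
  proof (rule Janiszewski_connected)
    show "closed (\<Union>e\<in>E. K e)"
      using insert by (intro closed_UN) (auto intro: compact_imp_closed)
    have "K x \<inter> (\<Union>e\<in>E. K e) = {}"
      using insert by blast
    then show "connected (K x \<inter> (\<Union>e\<in>E. K e))" by simp
  qed (use insert in auto)
  then show ?case by simp
qed (simp add: connected_UNIV)

text \<open>The parameters mapped into \<open>S\<close> form a compact set avoiding 0 and 1. A
  closed subinterval of the open unit interval covers it and gives a subarc, and an arc does not
  separate the plane.\<close>

lemma arc_between_subarc:
  assumes "arc_between e u v" "closed S" "u \<notin> S" "v \<notin> S"
  shows "\<exists>K \<subseteq> e - {u, v}. e \<inter> S \<subseteq> K \<and> compact K \<and> connected (- K)"
proof -
  obtain g where g: "arc g" "path_image g = e" "pathstart g = u" "pathfinish g = v"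
    using assms unfolding arc_between_def by blast
  have cont: "continuous_on {0..1} g" and inj: "inj_on g {0..1}"
    using g(1) unfolding arc_def path_def by auto
  have g01: "g 0 = u" "g 1 = v"
    using g(3,4) by (auto simp: pathstart_def pathfinish_def)
  define T where "T = {0..1} \<inter> g -` S"
  have compT: "compact T"
    using continuous_closed_preimage[OF cont _ assms(2)]
    by (simp add: T_def compact_eq_bounded_closed bounded_Int)
  have T01: "0 \<notin> T" "1 \<notin> T" and TS: "T \<subseteq> {0..1}"
    using g01 assms by (auto simp: T_def)
  have "\<exists>s t. 0 < s \<and> s < t \<and> t < 1 \<and> T \<subseteq> {s..t}"
  proof (cases "T = {}")
    case True
    then show ?thesis by (intro exI[of _ "1/3"] exI[of _ "2/3"]) auto
  next
    case False
    obtain s where s: "s \<in> T" "\<forall>x\<in>T. s \<le> x"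
      using compact_attains_inf[OF compT False] by blast
    obtain t where t: "t \<in> T" "\<forall>x\<in>T. x \<le> t"
      using compact_attains_sup[OF compT False] by blast
    have "0 < s" "t < 1" "s \<le> t"
      using s t T01 TS by (force simp: less_le subset_iff)+
    \<comment> \<open>The margins on both sides keep the new interval nondegenerate even if
      \<open>T\<close> is a single point, as \<open>arc_subpath_arc\<close> requires.\<close>
    moreover have "s / 2 \<le> x \<and> x \<le> (t + 1) / 2" if "x \<in> T" for x
    proof -
      have "s \<le> x" "x \<le> t" "0 < s" "t < 1" using s t that \<open>0 < s\<close> \<open>t < 1\<close> by auto
      then show ?thesis by (simp add: field_simps)
    qed
    ultimately show ?thesis
      by (intro exI[of _ "s / 2"] exI[of _ "(t + 1) / 2"]) auto
  qed
  then obtain s t where st: "0 < s" "s < t" "t < 1" "T \<subseteq> {s..t}" by blast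
  have arc: "arc (subpath s t g)"
    using g(1) st by (intro arc_subpath_arc) auto
  have im: "path_image (subpath s t g) = g ` {s..t}"
    using st by (simp add: path_image_subpath)
  show ?thesis
  proof (intro exI[of _ "g ` {s..t}"] conjI)
    show "g ` {s..t} \<subseteq> e - {u, v}"
    proof
      fix x assume "x \<in> g ` {s..t}"
      then obtain r where r: "r \<in> {s..t}" "x = g r" by blast
      then have "g r \<noteq> g 0" "g r \<noteq> g 1"
        using inj st by (auto dest!: inj_onD)
      then show "x \<in> e - {u, v}"
        using r st g(2) g01 unfolding path_image_def by auto
    qed
    show "e \<inter> S \<subseteq> g ` {s..t}"
      using st(4) g(2) unfolding T_def path_image_def by auto
    show "compact (g ` {s..t})"
      using compact_arc_image[OF arc] im by simp
    show "connected (- g ` {s..t})"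
      using connected_arc_complement[OF arc] im by simp
  qed
qed

text \<open>
  If a face had no vertex on its frontier, the frontier would lie in finitely many disjoint
  subarcs of edges. These do not separate the plane, so the face would contain everything
  outside of them, in particular the vertices.
\<close>

lemma face_verts_nonempty:
  assumes G: "plane_graph G" and F: "F \<in> faces G"
  shows "face_verts G F \<noteq> {}"
proof
  assume "face_verts G F = {}"
  then have noV: "verts G \<inter> frontier F = {}" by (simp add: face_verts_def)
  have "\<exists>K. K \<subseteq> e - verts G \<and> e \<inter> frontier F \<subseteq> K \<and> compact K \<and> connected (- K)"
    if e: "e \<in> edges G" for e
  proof -
    obtain u v where uv: "arc_between e u v" "e \<inter> verts G = {u, v}"
      using plane_graphD(4)[OF G e] by blast
    have "e - {u, v} = e - verts G" by (auto simp flip: uv(2))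
    moreover have "u \<in> verts G" "v \<in> verts G" using uv(2) by auto
    then have "u \<notin> frontier F" "v \<notin> frontier F" using noV by auto
    ultimately show ?thesis
      using arc_between_subarc[OF uv(1) frontier_closed[of F]] by metis
  qed
  then have "\<forall>e\<in>edges G. \<exists>K.
      K \<subseteq> e - verts G \<and> e \<inter> frontier F \<subseteq> K \<and> compact K \<and> connected (- K)"
    by blast
  from bchoice[OF this] obtain K where "\<forall>e\<in>edges G.
      K e \<subseteq> e - verts G \<and> e \<inter> frontier F \<subseteq> K e \<and> compact (K e) \<and> connected (- K e)"
    by blast
  then have K: "\<And>e. e \<in> edges G \<Longrightarrow>
      K e \<subseteq> e - verts G \<and> e \<inter> frontier F \<subseteq> K e \<and> compact (K e) \<and> connected (- K e)"
    by blast
  have FP: "F \<subseteq> - point_set G" "F \<noteq> {}"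
    using F in_components_subset in_components_nonempty unfolding faces_def by auto
  have "closed (point_set G)"
    using plane_graph_point_set_compact[OF G] compact_imp_closed by blast
  then have frP: "frontier F \<subseteq> point_set G"
    using frontier_of_components_closed_complement[of "point_set G" F] F
    unfolding faces_def by auto
  have conn: "connected (- (\<Union>e\<in>edges G. K e))"
  proof (rule disjoint_compacts_complement_connected)
    fix e e' assume e: "e \<in> edges G" "e' \<in> edges G" "e \<noteq> e'"
    then have "e \<inter> e' \<subseteq> verts G" by (rule plane_graphD(5)[OF G])
    then show "K e \<inter> K e' = {}" using K e by blast
  qed (use plane_graphD(3)[OF G] K in auto)
  have frK: "frontier F \<subseteq> (\<Union>e\<in>edges G. K e)"
    using frP noV K unfolding point_set_def by blast
  have KP: "(\<Union>e\<in>edges G. K e) \<subseteq> point_set G - verts G"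
    using K unfolding point_set_def by blast
  have "- (\<Union>e\<in>edges G. K e) \<subseteq> F"
  proof (rule ccontr)
    assume "\<not> ?thesis"
    moreover have "- (\<Union>e\<in>edges G. K e) \<inter> F \<noteq> {}" using FP KP by blast
    ultimately have "- (\<Union>e\<in>edges G. K e) \<inter> frontier F \<noteq> {}"
      by (intro connected_Int_frontier[OF conn]) auto
    then show False using frK by blast
  qed
  moreover have "verts G \<subseteq> - (\<Union>e\<in>edges G. K e)" "verts G \<noteq> {}"
    using KP plane_graphD(2)[OF G] by auto
  ultimately show False
    using FP unfolding point_set_def by blast
qed

section \<open>Existence of FUM-colorings and lower bounds for \<open>chi_fum\<close>\<close>

lemma fum_coloring_exists:
  assumes "plane_graph G"
  shows "\<exists>m c. fum_coloring G c \<and> c ` verts G \<subseteq> {1..m}"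
proof -
  have fin: "finite (verts G)" by (rule plane_graphD(1)[OF assms])
  obtain c :: "complex \<Rightarrow> nat" and m where c: "c ` verts G = {i. i < m}" "inj_on c (verts G)"
    using finite_imp_inj_to_nat_seg[OF fin] by blast
  \<comment> \<open>Adding 1 moves the colors from \<open>{0..<m}\<close> to
    \<open>{1..m}\<close>.\<close>
  have inj: "inj_on (\<lambda>v. c v + 1) (verts G)"
    using c(2) by (auto simp: inj_on_def)
  have "fum_coloring G (\<lambda>v. c v + 1)"
    unfolding fum_coloring_def
  proof
    show "proper_coloring G (\<lambda>v. c v + 1)"
      using inj arc_between_ends
      unfolding proper_coloring_def adjacent_def inj_on_def by metis
    show "\<forall>F\<in>faces G. unique_max_color G (\<lambda>v. c v + 1) F"
    proof
      fix F assume "F \<in> faces G"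
      then have ne: "face_verts G F \<noteq> {}" by (rule face_verts_nonempty[OF assms])
      have sub: "face_verts G F \<subseteq> verts G" by (auto simp: face_verts_def)
      have "Max ((\<lambda>v. c v + 1) ` face_verts G F) \<in> (\<lambda>v. c v + 1) ` face_verts G F"
        using ne finite_subset[OF sub fin] by (intro Max_in) auto
      then obtain v where v: "v \<in> face_verts G F"
          "c v + 1 = Max ((\<lambda>v. c v + 1) ` face_verts G F)"
        by (metis (lifting) imageE)
      then show "unique_max_color G (\<lambda>v. c v + 1) F"
        unfolding unique_max_color_def
        using inj_onD[OF inj] subsetD[OF sub] by (intro ex1I[of _ v]) (metis (lifting))+
    qed
  qed
  moreover have "(\<lambda>v. c v + 1) ` verts G \<subseteq> {1..m}"
    using c(1) by (auto simp: set_eq_iff image_iff Suc_le_eq)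
  ultimately show ?thesis by blast
qed

text \<open>The \<open>LEAST\<close> in \<open>chi_fum\<close> is attained because some FUM-coloring
  exists; if it were at most \<open>n\<close>, the coloring attaining it would use only colors in
  \<open>{1..n}\<close>.\<close>

lemma chi_fum_greaterI:
  assumes "plane_graph G"
    and "\<And>c. fum_coloring G c \<Longrightarrow> c ` verts G \<subseteq> {1..n} \<Longrightarrow> False"
  shows "chi_fum G > n"
proof (rule ccontr)
  assume "\<not> chi_fum G > n"
  moreover have "\<exists>c. fum_coloring G c \<and> c ` verts G \<subseteq> {1..chi_fum G}"
    unfolding chi_fum_def by (rule LeastI_ex[OF fum_coloring_exists[OF assms(1)]])
  ultimately show False
    using assms(2) by (meson atLeastatMost_subset_iff dual_order.trans le_refl not_less)
qed

section \<open>The cycles of \<open>H\<^sub>k\<close>\<close>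

lemma nxt_in: "i \<in> {1..3 * k + 1} \<Longrightarrow> nxt k i \<in> {1..3 * k + 1}"
  by (auto simp: nxt_def)

text \<open>The first \<open>3 * k\<close> arcs are concatenated into one arc by induction, and the
  last arc closes it up. This makes the Jordan curve theorem available for both cycles, which are
  given only as unions of edges.\<close>

lemma cyclic_arcs_simple_loop:
  fixes a :: "nat \<Rightarrow> complex" and e :: "nat \<Rightarrow> complex set"
  assumes k: "1 \<le> k" and inj: "inj_on a {1..3 * k + 1}"
    and arcs: "\<And>i. i \<in> {1..3 * k + 1} \<Longrightarrow> arc_between (e i) (a i) (a (nxt k i))"
    and disj: "\<And>i j. i \<in> {1..3 * k + 1} \<Longrightarrow> j \<in> {1..3 * k + 1} \<Longrightarrow> i \<noteq> j \<Longrightarrow>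
      e i \<inter> e j \<subseteq> {a i, a (nxt k i)}"
  shows "\<exists>g. simple_path g \<and> pathfinish g = pathstart g \<and> path_image g = (\<Union>i\<in>{1..3 * k + 1}. e i)"
proof -
  have sub: "e i \<inter> e j \<subseteq> {a i, a (nxt k i)} \<inter> {a j, a (nxt k j)}"
    if "i \<in> {1..3 * k + 1}" "j \<in> {1..3 * k + 1}" "i \<noteq> j" for i j
    using disj[of i j] disj[of j i] that by blast
  have partial: "\<exists>g. arc g \<and> path_image g = (\<Union>i\<in>{1..m}. e i) \<and> pathstart g = a 1 \<and> pathfinish g = a (Suc m)"
    if "1 \<le> m" "m \<le> 3 * k" for m
    using that
  proof (induction m rule: nat_induct_at_least)
    case base
    have "arc_between (e 1) (a 1) (a (Suc 1))"
      using arcs[of 1] k by (simp add: nxt_def)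
    then show ?case unfolding arc_between_def by auto
  next
    case (Suc m)
    then obtain g where g: "arc g" "path_image g = (\<Union>i\<in>{1..m}. e i)" "pathstart g = a 1"
      "pathfinish g = a (Suc m)" by auto
    have "arc_between (e (Suc m)) (a (Suc m)) (a (Suc (Suc m)))"
      using arcs[of "Suc m"] Suc by (simp add: nxt_def)
    then obtain h where h: "arc h" "path_image h = e (Suc m)" "pathstart h = a (Suc m)"
      "pathfinish h = a (Suc (Suc m))"
      unfolding arc_between_def by blast
    \<comment> \<open>Since \<open>Suc (Suc m) \<le> 3 * k + 1\<close>, no index wraps around here,
      so the new end \<open>a (Suc (Suc m))\<close> is not an end of an earlier arc.\<close>
    have "e i \<inter> e (Suc m) \<subseteq> {a (Suc m)}" if "i \<in> {1..m}" for i
    proof -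
      have "a i \<noteq> a (Suc (Suc m))" "a (Suc i) \<noteq> a (Suc (Suc m))"
        using that Suc by (auto simp: inj_on_eq_iff[OF inj])
      moreover have "nxt k i = Suc i" "nxt k (Suc m) = Suc (Suc m)"
        using that Suc by (auto simp: nxt_def)
      ultimately show ?thesis
        using sub[of i "Suc m"] that Suc by auto
    qed
    then have "path_image g \<inter> path_image h \<subseteq> {pathstart h}"
      unfolding g h by blast
    then have "arc (g +++ h)"
      using g h by (intro arc_join) auto
    moreover have "path_image (g +++ h) = (\<Union>i\<in>{1..Suc m}. e i)"
      using g h by (subst path_image_join) (auto simp: atLeastAtMostSuc_conv)
    ultimately show ?case
      using g h by (intro exI[of _ "g +++ h"]) auto
  qed
  obtain g where g: "arc g" "path_image g = (\<Union>i\<in>{1..3 * k}. e i)" "pathstart g = a 1"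
    "pathfinish g = a (3 * k + 1)"
    using partial[of "3 * k"] k by auto
  have nx: "nxt k (3 * k + 1) = 1" by (simp add: nxt_def)
  then obtain h where h: "arc h" "path_image h = e (3 * k + 1)" "pathstart h = a (3 * k + 1)"
      "pathfinish h = a 1"
    using arcs[of "3 * k + 1"] unfolding arc_between_def by auto
  have "e i \<inter> e (3 * k + 1) \<subseteq> {a 1, a (3 * k + 1)}" if "i \<in> {1..3 * k}" for i
    using disj[of "3 * k + 1" i] that by (auto simp: nxt_def)
  then have "path_image g \<inter> path_image h \<subseteq> {pathstart g, pathstart h}"
    unfolding g h by blast
  then have "simple_path (g +++ h)"
    using g h by (intro simple_path_join_loop) auto
  moreover have "path_image (g +++ h) = (\<Union>i\<in>{1..3 * k + 1}. e i)"
    using g h by (subst path_image_join) (auto simp: atLeastAtMostSuc_conv)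
  ultimately show ?thesis
    using g h by (intro exI[of _ "g +++ h"]) auto
qed

section \<open>Jordan curves and faces of a labelled drawing\<close>

lemma H_labelledD:
  assumes "H_labelled k a b H"
  shows "plane_graph H" "inj_on a {1..3 * k + 1}" "inj_on b {1..3 * k + 1}"
    "a ` {1..3 * k + 1} \<inter> b ` {1..3 * k + 1} = {}"
    "verts H = a ` {1..3 * k + 1} \<union> b ` {1..3 * k + 1}"
  using assms unfolding H_labelled_def Let_def by simp_all

lemma H_labelled_adjacent:
  assumes "H_labelled k a b H" "i \<in> {1..3 * k + 1}"
  shows "adjacent H (a i) (a (nxt k i))" "adjacent H (b i) (b (nxt k i))"
    "adjacent H (a i) (b i)" "adjacent H (b i) (a (nxt k i))"
proof -
  define I where "I = {1..3 * k + 1}"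
  obtain ea eb ep eq where "edges H = ea ` I \<union> eb ` I \<union> ep ` I \<union> eq ` I"
    "\<forall>i\<in>I. arc_between (ea i) (a i) (a (nxt k i)) \<and> arc_between (eb i) (b i) (b (nxt k i)) \<and>
      arc_between (ep i) (a i) (b i) \<and> arc_between (eq i) (b i) (a (nxt k i))"
    using assms(1) unfolding H_labelled_def Let_def I_def by auto
  then show "adjacent H (a i) (a (nxt k i))" "adjacent H (b i) (b (nxt k i))"
    "adjacent H (a i) (b i)" "adjacent H (b i) (a (nxt k i))"
    using assms(2) unfolding adjacent_def I_def[symmetric] by auto
qed

text \<open>The two cycles are Jordan curves \<gamma> and \<delta>. The inner cycle lies inside
  \<gamma>, the outer one outside \<delta>, and each added edge runs between them; so \<gamma>
  encloses the rest of the graph, while no point of it lies inside \<delta>.\<close>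

lemma H_labelled_cycles:
  assumes H: "H_labelled k a b H" and k: "1 \<le> k"
  obtains \<gamma> \<delta> where
    "simple_path \<gamma>" "pathfinish \<gamma> = pathstart \<gamma>" "path_image \<gamma> \<inter> verts H = a ` {1..3 * k + 1}"
    "path_image \<gamma> \<subseteq> point_set H" "point_set H \<subseteq> path_image \<gamma> \<union> inside (path_image \<gamma>)"
    "simple_path \<delta>" "pathfinish \<delta> = pathstart \<delta>" "path_image \<delta> \<inter> verts H = b ` {1..3 * k + 1}"
    "path_image \<delta> \<subseteq> point_set H" "inside (path_image \<delta>) \<inter> point_set H = {}"
proof -
  define I where "I = {1..3 * k + 1}"
  note D = H_labelledD[OF H, folded I_def]
  note nxtI = nxt_in[of _ k, folded I_def]
  obtain ea eb ep eq where E: "edges H = ea ` I \<union> eb ` I \<union> ep ` I \<union> eq ` I"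
    and arcs: "\<forall>i\<in>I. arc_between (ea i) (a i) (a (nxt k i)) \<and>
                 arc_between (eb i) (b i) (b (nxt k i)) \<and>
                 arc_between (ep i) (a i) (b i) \<and>
                 arc_between (eq i) (b i) (a (nxt k i))"
    and BinA: "(\<Union>i\<in>I. eb i) \<subseteq> inside (\<Union>i\<in>I. ea i)"
    and p: "\<forall>i\<in>I. ep i - {a i, b i} \<subseteq> inside (\<Union>i\<in>I. ea i) \<inter> outside (\<Union>i\<in>I. eb i)"
    and q: "\<forall>i\<in>I. eq i - {b i, a (nxt k i)} \<subseteq> inside (\<Union>i\<in>I. ea i) \<inter> outside (\<Union>i\<in>I. eb i)"
    using H unfolding H_labelled_def Let_def I_def by auto
  have endsA: "ea i \<inter> verts H = {a i, a (nxt k i)}" if "i \<in> I" for i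
    using that arcs E nxtI[OF that] D(5) by (intro plane_graph_edge_ends[OF D(1)]) auto
  have endsB: "eb i \<inter> verts H = {b i, b (nxt k i)}" if "i \<in> I" for i
    using that arcs E nxtI[OF that] D(5) by (intro plane_graph_edge_ends[OF D(1)]) auto
  \<comment> \<open>The cycles have at least 4 vertices, so two indices are never successors of each
    other and distinct edges of a cycle cannot share both ends.\<close>
  have nxt_nxt: "nxt k (nxt k x) \<noteq> x" if "x \<in> I" for x
    using that k by (auto simp: nxt_def I_def)
  have neqA: "ea i \<noteq> ea j" if "i \<in> I" "j \<in> I" "i \<noteq> j" for i j
  proof
    assume "ea i = ea j"
    then have "{a i, a (nxt k i)} = {a j, a (nxt k j)}" using endsA that by metis
    then have "a i = a (nxt k j)" "a j = a (nxt k i)"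
      using that inj_onD[OF D(2)] by (auto simp: doubleton_eq_iff)
    then show False
      using that nxtI nxt_nxt inj_onD[OF D(2)] by metis
  qed
  have neqB: "eb i \<noteq> eb j" if "i \<in> I" "j \<in> I" "i \<noteq> j" for i j
  proof
    assume "eb i = eb j"
    then have "{b i, b (nxt k i)} = {b j, b (nxt k j)}" using endsB that by metis
    then have "b i = b (nxt k j)" "b j = b (nxt k i)"
      using that inj_onD[OF D(3)] by (auto simp: doubleton_eq_iff)
    then show False
      using that nxtI nxt_nxt inj_onD[OF D(3)] by metis
  qed
  have disjA: "ea i \<inter> ea j \<subseteq> {a i, a (nxt k i)}" if "i \<in> I" "j \<in> I" "i \<noteq> j" for i j
    using plane_graphD(5)[OF D(1), of "ea i" "ea j"] neqA[OF that] endsA[OF that(1)] that E by blast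
  have disjB: "eb i \<inter> eb j \<subseteq> {b i, b (nxt k i)}" if "i \<in> I" "j \<in> I" "i \<noteq> j" for i j
    using plane_graphD(5)[OF D(1), of "eb i" "eb j"] neqB[OF that] endsB[OF that(1)] that E by blast
  obtain \<gamma> where g: "simple_path \<gamma>" "pathfinish \<gamma> = pathstart \<gamma>" "path_image \<gamma> = (\<Union>i\<in>I. ea i)"
    using cyclic_arcs_simple_loop[of k a ea, folded I_def] k D(2) arcs disjA by metis
  obtain \<delta> where d: "simple_path \<delta>" "pathfinish \<delta> = pathstart \<delta>" "path_image \<delta> = (\<Union>i\<in>I. eb i)"
    using cyclic_arcs_simple_loop[of k b eb, folded I_def] k D(3) arcs disjB by metis
  have aA: "path_image \<gamma> \<inter> verts H = a ` I"
  proof -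
    have "path_image \<gamma> \<inter> verts H = (\<Union>i\<in>I. ea i \<inter> verts H)" unfolding g(3) by blast
    also have "\<dots> = (\<Union>i\<in>I. {a i, a (nxt k i)})" using endsA by simp
    also have "\<dots> = a ` I" using nxtI by blast
    finally show ?thesis .
  qed
  have bB: "path_image \<delta> \<inter> verts H = b ` I"
  proof -
    have "path_image \<delta> \<inter> verts H = (\<Union>i\<in>I. eb i \<inter> verts H)" unfolding d(3) by blast
    also have "\<dots> = (\<Union>i\<in>I. {b i, b (nxt k i)})" using endsB by simp
    also have "\<dots> = b ` I" using nxtI by blast
    finally show ?thesis .
  qed
  have P: "point_set H = path_image \<gamma> \<union> path_image \<delta> \<union> (\<Union>i\<in>I. ep i) \<union> (\<Union>i\<in>I. eq i)"
  proof -
    have "verts H \<subseteq> path_image \<gamma> \<union> path_image \<delta>" using aA bB D(5) by blast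
    then show ?thesis unfolding point_set_def E g d by blast
  qed
  have JA: "open (inside (path_image \<gamma>))" "connected (outside (path_image \<gamma>))"
    "\<not> bounded (outside (path_image \<gamma>))" "frontier (outside (path_image \<gamma>)) = path_image \<gamma>"
    "inside (path_image \<gamma>) \<inter> outside (path_image \<gamma>) = {}"
    using Jordan_inside_outside[OF g(1,2)] by auto
  have BA: "path_image \<delta> \<subseteq> inside (path_image \<gamma>)" using BinA g d by simp
  \<comment> \<open>The definition places the inner cycle inside the outer one. Conversely, the
    closed exterior of \<gamma> is connected, unbounded and disjoint from \<delta>, so it lies in
    the unbounded part of the complement of \<delta>.\<close>
  have A_out: "path_image \<gamma> \<subseteq> outside (path_image \<delta>)"
  proof
    fix x assume x: "x \<in> path_image \<gamma>"
    let ?C = "closure (outside (path_image \<gamma>))"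
    have C: "?C = outside (path_image \<gamma>) \<union> path_image \<gamma>"
      using JA(4) closure_Un_frontier by metis
    have "?C \<subseteq> - path_image \<delta>"
      using BA JA(5) inside_no_overlap[of "path_image \<gamma>"] unfolding C by blast
    moreover have "connected ?C" using JA(2) by (rule connected_imp_connected_closure)
    moreover have "x \<in> ?C" using x C by simp
    ultimately have "?C \<subseteq> connected_component_set (- path_image \<delta>) x"
      by (intro connected_component_maximal)
    then have "\<not> bounded (connected_component_set (- path_image \<delta>) x)"
      using JA(3) bounded_subset closure_subset by (metis)
    then show "x \<in> outside (path_image \<delta>)"
      using \<open>?C \<subseteq> - path_image \<delta>\<close> \<open>x \<in> ?C\<close> by (auto simp: outside_def)
  qed
  have "a i \<in> path_image \<gamma>" "b i \<in> path_image \<delta>" if "i \<in> I" for i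
    using aA bB that by blast+
  note ab = this
  have p': "ep i \<subseteq> inside (path_image \<gamma>) \<union> path_image \<gamma>" "ep i \<subseteq> outside (path_image \<delta>) \<union> path_image \<delta>"
    if "i \<in> I" for i
  proof -
    have "ep i - {a i, b i} \<subseteq> inside (path_image \<gamma>) \<inter> outside (path_image \<delta>)"
      using p that unfolding g d by simp
    moreover have "{a i, b i} \<subseteq> inside (path_image \<gamma>) \<union> path_image \<gamma>"
      "{a i, b i} \<subseteq> outside (path_image \<delta>) \<union> path_image \<delta>"
      using ab[OF that] subsetD[OF BA] subsetD[OF A_out] by auto
    ultimately show "ep i \<subseteq> inside (path_image \<gamma>) \<union> path_image \<gamma>"
      "ep i \<subseteq> outside (path_image \<delta>) \<union> path_image \<delta>" by blast+
  qed
  have q': "eq i \<subseteq> inside (path_image \<gamma>) \<union> path_image \<gamma>" "eq i \<subseteq> outside (path_image \<delta>) \<union> path_image \<delta>"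
    if "i \<in> I" for i
  proof -
    have "eq i - {b i, a (nxt k i)} \<subseteq> inside (path_image \<gamma>) \<inter> outside (path_image \<delta>)"
      using q that unfolding g d by simp
    moreover have "{b i, a (nxt k i)} \<subseteq> inside (path_image \<gamma>) \<union> path_image \<gamma>"
      "{b i, a (nxt k i)} \<subseteq> outside (path_image \<delta>) \<union> path_image \<delta>"
      using ab(1)[OF nxtI[OF that]] ab(2)[OF that] subsetD[OF BA] subsetD[OF A_out] by auto
    ultimately show "eq i \<subseteq> inside (path_image \<gamma>) \<union> path_image \<gamma>"
      "eq i \<subseteq> outside (path_image \<delta>) \<union> path_image \<delta>" by blast+
  qed
  have P1: "point_set H \<subseteq> path_image \<gamma> \<union> inside (path_image \<gamma>)"
    unfolding P using BA p'(1) q'(1) by blast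
  have "point_set H \<subseteq> path_image \<delta> \<union> outside (path_image \<delta>)"
    unfolding P using A_out p'(2) q'(2) by blast
  then have P2: "inside (path_image \<delta>) \<inter> point_set H = {}"
    using inside_no_overlap[of "path_image \<delta>"] inside_Int_outside[of "path_image \<delta>"] by blast
  show thesis
    by (rule that[OF g(1,2) aA[unfolded I_def] _ P1 d(1,2) bB[unfolded I_def] _ P2]) (auto simp: P)
qed

text \<open>The exterior of \<gamma> misses the graph and has \<gamma> as its frontier, so it is a
  face; being unbounded, it is the outer one, and all \<open>a i\<close> lie on its
  frontier.\<close>

lemma H_labelled_outer_face:
  assumes H: "H_labelled k a b H" and k: "1 \<le> k"
  obtains \<gamma> where "simple_path \<gamma>" "pathfinish \<gamma> = pathstart \<gamma>" "path_image \<gamma> \<subseteq> point_set H"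
    "a ` {1..3 * k + 1} \<subseteq> path_image \<gamma>" "point_set H \<subseteq> path_image \<gamma> \<union> inside (path_image \<gamma>)"
    "outer_face H = outside (path_image \<gamma>)" "outer_face H \<in> faces H" "\<not> bounded (outer_face H)"
    "a ` {1..3 * k + 1} \<subseteq> face_verts H (outer_face H)"
proof -
  obtain \<gamma> where g:
    "simple_path \<gamma>" "pathfinish \<gamma> = pathstart \<gamma>" "path_image \<gamma> \<inter> verts H = a ` {1..3 * k + 1}"
    "path_image \<gamma> \<subseteq> point_set H" "point_set H \<subseteq> path_image \<gamma> \<union> inside (path_image \<gamma>)"
    using H_labelled_cycles[OF assms] by metis
  let ?O = "outside (path_image \<gamma>)"
  have J: "connected ?O" "?O \<noteq> {}" "\<not> bounded ?O" "frontier ?O = path_image \<gamma>"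
    using Jordan_inside_outside[OF g(1,2)] by auto
  have "?O \<inter> point_set H = {}"
    using g(5) outside_no_overlap[of "path_image \<gamma>"] inside_Int_outside[of "path_image \<gamma>"] by blast
  then have F: "?O \<in> faces H"
    unfolding faces_def using J g(4) by (intro component_of_frontier_subset) auto
  have bd: "bounded (point_set H)"
    using plane_graph_point_set_compact[OF H_labelledD(1)[OF H]] compact_imp_bounded by blast
  have O: "outer_face H = ?O"
    by (rule outer_face_eqI[OF bd F J(3)])
  show thesis
    using that[of \<gamma>] g F J by (auto simp: O face_verts_def)
qed

lemma H_labelled_inner_face:
  assumes H: "H_labelled k a b H" and k: "1 \<le> k"
  obtains F where "F \<in> interior_faces H" "face_verts H F = b ` {1..3 * k + 1}"
proof -
  obtain \<delta> where d:
    "simple_path \<delta>" "pathfinish \<delta> = pathstart \<delta>" "path_image \<delta> \<inter> verts H = b ` {1..3 * k + 1}"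
    "path_image \<delta> \<subseteq> point_set H" "inside (path_image \<delta>) \<inter> point_set H = {}"
    using H_labelled_cycles[OF assms] by metis
  let ?F = "inside (path_image \<delta>)"
  have J: "connected ?F" "?F \<noteq> {}" "bounded ?F" "frontier ?F = path_image \<delta>"
    using Jordan_inside_outside[OF d(1,2)] by auto
  have F: "?F \<in> faces H"
    unfolding faces_def using J d(4,5) by (intro component_of_frontier_subset) auto
  have "\<not> bounded (outer_face H)"
    using H_labelled_outer_face[OF assms] by metis
  then have "?F \<in> interior_faces H"
    using F J(3) unfolding interior_faces_def by auto
  moreover have "face_verts H ?F = b ` {1..3 * k + 1}"
    using J(4) d(3) by (auto simp: face_verts_def)
  ultimately show thesis by (rule that)
qed

section \<open>Colorings of \<open>H\<^sub>k\<close>\<close>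

lemma third_color_unique:
  fixes p q x y :: nat
  assumes "{p, q, x, y} \<subseteq> {1, 2, 3}" "p \<noteq> q" "x \<noteq> p" "x \<noteq> q" "y \<noteq> p" "y \<noteq> q"
  shows "x = y"
  using assms by auto

text \<open>
  Starting after a \<open>j\<close> such that \<open>\<beta> i \<noteq> 4\<close> for all \<open>i \<noteq> j\<close>, consecutive triangles force the
  colors \<open>\<alpha>\<close> to have period 3, so that \<open>\<alpha> (j + 1) = \<alpha> (j + 1 + 3 k) = \<alpha> j\<close>.
\<close>

lemma no_strip_coloring:
  fixes \<alpha> \<beta> :: "nat \<Rightarrow> nat"
  assumes k: "1 \<le> k"
    and ne: "\<And>i. i \<in> {1..3 * k + 1} \<Longrightarrow> \<alpha> i \<noteq> \<alpha> (nxt k i) \<and> \<beta> i \<noteq> \<beta> (nxt k i) \<and> \<alpha> i \<noteq> \<beta> i \<and> \<beta> i \<noteq> \<alpha> (nxt k i)"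
    and \<alpha>: "\<And>i. i \<in> {1..3 * k + 1} \<Longrightarrow> \<alpha> i \<in> {1, 2, 3}"
    and \<beta>: "\<And>i. i \<in> {1..3 * k + 1} \<Longrightarrow> \<beta> i \<in> {1, 2, 3, 4}"
    and uniq: "\<And>i j. i \<in> {1..3 * k + 1} \<Longrightarrow> j \<in> {1..3 * k + 1} \<Longrightarrow> \<beta> i = 4 \<Longrightarrow> \<beta> j = 4 \<Longrightarrow> i = j"
  shows False
proof -
  define n where "n = 3 * k + 1"
  \<comment> \<open>If \<open>\<beta>\<close> never takes the value 4, any index could serve as
    \<open>j\<close>; 1 is taken.\<close>
  obtain j where j: "j \<in> {1..n}" "\<And>i. i \<in> {1..n} \<Longrightarrow> i \<noteq> j \<Longrightarrow> \<beta> i \<in> {1, 2, 3}"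
  proof (cases "\<exists>j\<in>{1..n}. \<beta> j = 4")
    case True
    then obtain j where "j \<in> {1..n}" "\<beta> j = 4" by blast
    then show thesis using that[of j] \<beta> uniq unfolding n_def by blast
  next
    case False
    then show thesis using that[of 1] \<beta> unfolding n_def by fastforce
  qed
  \<comment> \<open>The walk around the cycle starts at the successor of \<open>j\<close> and
    arrives at \<open>j\<close> after \<open>3 * k\<close> steps: \<open>s 0 = nxt k j\<close> and
    \<open>s (3 * k) = j\<close>. The final \<open>+ 1\<close> brings residues into the range
    \<open>{1..n}\<close>.\<close>
  define s where "s m = (j + m) mod n + 1" for m
  have s_in: "s m \<in> {1..n}" for m
    unfolding s_def n_def by (auto simp: less_Suc_eq_le[symmetric])
  have s_Suc: "nxt k (s m) = s (Suc m)" for m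
    unfolding s_def nxt_def n_def by (auto simp: mod_Suc)
  have s_ne: "s m \<noteq> j" if "m < 3 * k" for m
  proof
    assume eq: "s m = j"
    show False
    proof (cases "j + m < n")
      case True
      then show False using eq by (simp add: s_def)
    next
      case False
      then have "(j + m) mod n = j + m - n"
        using that j(1) by (simp add: mod_if n_def)
      then show False using eq False that by (simp add: s_def n_def)
    qed
  qed
  have x: "\<alpha> (s m) \<in> {1, 2, 3}" for m using \<alpha> s_in n_def by simp
  have y: "\<beta> (s m) \<in> {1, 2, 3}" if "m < 3 * k" for m using j(2)[OF s_in s_ne[OF that]] .
  have d: "\<alpha> (s m) \<noteq> \<alpha> (s (Suc m))" "\<beta> (s m) \<noteq> \<beta> (s (Suc m))" "\<alpha> (s m) \<noteq> \<beta> (s m)" "\<beta> (s m) \<noteq> \<alpha> (s (Suc m))" for m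
    using ne[of "s m"] s_in[of m] s_Suc n_def by auto
  have period: "\<alpha> (s (Suc (Suc (Suc m)))) = \<alpha> (s m)" if "Suc (Suc m) < 3 * k" for m
  proof -
    \<comment> \<open>Two triangles sharing an edge have equal colors opposite to it. Here they
      share the edge from the inner vertex \<open>s m\<close> to the outer vertex
      \<open>s (Suc m)\<close>; for the second equation, the edge between the outer and the inner
      vertex \<open>s (Suc (Suc m))\<close>.\<close>
    have 1: "\<beta> (s (Suc m)) = \<alpha> (s m)"
      using d[of m] d[of "Suc m"] x[of m] x[of "Suc m"] y[of m] y[of "Suc m"] that
      by (intro third_color_unique[of "\<beta> (s m)" "\<alpha> (s (Suc m))"]) auto
    have 2: "\<alpha> (s (Suc (Suc (Suc m)))) = \<beta> (s (Suc m))"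
      using d[of "Suc m"] d[of "Suc (Suc m)"] x[of "Suc (Suc m)"] x[of "Suc (Suc (Suc m))"]
        y[of "Suc m"] y[of "Suc (Suc m)"] that
      by (intro third_color_unique[of "\<alpha> (s (Suc (Suc m)))" "\<beta> (s (Suc (Suc m)))"]) auto
    show ?thesis using 1 2 by simp
  qed
  have "\<alpha> (s (3 * t)) = \<alpha> (s 0)" if "t \<le> k" for t
    using that
  proof (induction t)
    case (Suc t)
    then show ?case using period[of "3 * t"] by (simp add: numeral_3_eq_3)
  qed simp
  then have "\<alpha> (s (3 * k)) = \<alpha> (s 0)" by simp
  moreover have "s (3 * k) = j"
  proof -
    have "(j + 3 * k) mod n = (j - 1 + n) mod n" using j(1) by (simp add: n_def)
    also have "\<dots> = (j - 1) mod n" by (rule mod_add_self2)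
    also have "\<dots> = j - 1" using j(1) by (intro mod_less) auto
    finally show ?thesis using j(1) by (simp add: s_def)
  qed
  moreover have "s 0 = nxt k j"
    using j(1) by (auto simp: s_def nxt_def n_def)
  ultimately show False
    using ne[of j] j(1) n_def by simp
qed

text \<open>A color 4 on the inner cycle is the maximum on the inner face and therefore occurs there
  at most once. With no 4 on the outer cycle, the coloring would satisfy the hypotheses of
  \<open>no_strip_coloring\<close>.\<close>

lemma H_labelled_outer_color_4:
  assumes H: "H_labelled k a b H" and k: "1 \<le> k"
    and proper: "proper_coloring H c" and colors: "c ` verts H \<subseteq> {1, 2, 3, 4}"
    and um: "\<And>F. F \<in> interior_faces H \<Longrightarrow> unique_max_color H c F"
  shows "\<exists>i\<in>{1..3 * k + 1}. c (a i) = 4"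
proof (rule ccontr)
  assume no4: "\<not> ?thesis"
  note D = H_labelledD[OF H]
  have V: "a i \<in> verts H" "b i \<in> verts H" if "i \<in> {1..3 * k + 1}" for i
    using that D(5) by auto
  have ne: "c u \<noteq> c v" if "adjacent H u v" "u \<in> verts H" "v \<in> verts H" for u v
    using proper that unfolding proper_coloring_def by blast
  obtain F where F: "F \<in> interior_faces H" "face_verts H F = b ` {1..3 * k + 1}"
    using H_labelled_inner_face[OF H k] .
  show False
  proof (rule no_strip_coloring[OF k, of "c \<circ> a" "c \<circ> b"], goal_cases)
    case (1 i)
    then show ?case
      using ne H_labelled_adjacent[OF H 1] V nxt_in[OF 1] by auto
  next
    case (2 i)
    then have "c (a i) \<in> {1, 2, 3, 4}" using V colors by blast
    then show ?case using no4 2 by auto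
  next
    case (3 i)
    then have "c (b i) \<in> {1, 2, 3, 4}" using V colors by blast
    then show ?case by simp
  next
    case (4 i j)
    have "c v \<le> 4" if "v \<in> face_verts H F" for v
    proof -
      have "c v \<in> {1, 2, 3, 4}" using colors that unfolding face_verts_def by blast
      then show ?thesis by auto
    qed
    moreover have bi: "b i \<in> face_verts H F" "b j \<in> face_verts H F" using 4 F(2) by auto
    moreover have "4 \<in> c ` face_verts H F" using bi(1) 4(3) by force
    moreover have "finite (face_verts H F)" using F(2) by simp
    ultimately have "Max (c ` face_verts H F) = 4"
      by (intro Max_eqI) blast+
    then have "b i = b j"
      using um[OF F(1)] bi 4(3,4) unfolding unique_max_color_def by auto
    then show ?case using inj_onD[OF D(3)] 4 by blast
  qed
qed

lemma H_labelled_card: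
  assumes "H_labelled k a b H"
  shows "card (verts H) = 6 * k + 2"
  using H_labelledD[OF assms] by (simp add: card_Un_disjoint card_image)

section \<open>Two copies of \<open>H\<^sub>k\<close> joined by an edge\<close>

lemma arc_between_sym: "arc_between e u v \<Longrightarrow> arc_between e v u"
  unfolding arc_between_def
  by (metis arc_reversepath path_image_reversepath pathfinish_reversepath pathstart_reversepath)

text \<open>The complement of the outer face is the closed Jordan disc bounded by the outer cycle.
  These are the facts that Janiszewski's theorem and the frontier computations for the joined graph
  call for.\<close>

lemma H_labelled_outer_face_complement:
  assumes H: "H_labelled k a b H" and k: "1 \<le> k"
  shows "compact (- outer_face H)" "connected (- outer_face H)" "connected (outer_face H)"
    "outer_face H \<in> faces H" "frontier (outer_face H) \<subseteq> point_set H"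
    "point_set H \<subseteq> - outer_face H" "a ` {1..3 * k + 1} \<subseteq> frontier (outer_face H)"
    "open (outer_face H)"
proof -
  obtain \<gamma> where g: "simple_path \<gamma>" "pathfinish \<gamma> = pathstart \<gamma>" "path_image \<gamma> \<subseteq> point_set H"
    "a ` {1..3 * k + 1} \<subseteq> path_image \<gamma>" "point_set H \<subseteq> path_image \<gamma> \<union> inside (path_image \<gamma>)"
    "outer_face H = outside (path_image \<gamma>)" "outer_face H \<in> faces H"
    using H_labelled_outer_face[OF assms] by metis
  have J: "connected (inside (path_image \<gamma>))" "bounded (inside (path_image \<gamma>))"
    "frontier (inside (path_image \<gamma>)) = path_image \<gamma>" "frontier (outside (path_image \<gamma>)) = path_image \<gamma>"
    "connected (outside (path_image \<gamma>))" "open (outside (path_image \<gamma>))"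
    using Jordan_inside_outside[OF g(1,2)] by auto
  have "- outer_face H = path_image \<gamma> \<union> inside (path_image \<gamma>)"
    unfolding g(6) outside_inside by auto
  also have "\<dots> = closure (inside (path_image \<gamma>))"
    using J(3) closure_Un_frontier[of "inside (path_image \<gamma>)"] by auto
  finally have C: "- outer_face H = closure (inside (path_image \<gamma>))" .
  show "compact (- outer_face H)" "connected (- outer_face H)"
    unfolding C using J by (auto simp: connected_imp_connected_closure)
  show "connected (outer_face H)" "outer_face H \<in> faces H" "frontier (outer_face H) \<subseteq> point_set H"
    "a ` {1..3 * k + 1} \<subseteq> frontier (outer_face H)" "open (outer_face H)"
    using J g by (auto simp: g(6))
  then show "point_set H \<subseteq> - outer_face H"
    using in_components_subset unfolding faces_def by blast
qed

text \<open>Everything that \<open>G\<close> adds to \<open>H\<close> lies in the outer face of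
  \<open>H\<close>, so it touches neither \<open>F\<close> nor the frontier of
  \<open>F\<close>.\<close>

lemma interior_face_of_copy:
  assumes H: "H_labelled k a b H" and k: "1 \<le> k"
    and sub: "point_set H \<subseteq> point_set G" "verts H \<subseteq> verts G"
    and rest: "point_set G \<subseteq> point_set H \<union> outer_face H" "verts G \<subseteq> verts H \<union> outer_face H"
    and F: "F \<in> interior_faces H"
  shows "F \<in> faces G" "face_verts G F = face_verts H F"
proof -
  note O = H_labelled_outer_face_complement[OF H k]
  have F': "F \<in> faces H" "F \<noteq> outer_face H" using F unfolding interior_faces_def by auto
  have "F \<inter> outer_face H = {}"
    using components_nonoverlap[of F "- point_set H" "outer_face H"] F' O(4)
    unfolding faces_def by auto
  moreover have "F \<inter> point_set H = {}" "F \<noteq> {}" "connected F"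
    using F'(1) in_components_subset in_components_nonempty in_components_connected
    unfolding faces_def by blast+
  moreover have "closed (point_set H)"
    using plane_graph_point_set_compact[OF H_labelledD(1)[OF H]] compact_imp_closed by blast
  then have fr: "frontier F \<subseteq> point_set H"
    using frontier_of_components_closed_complement F'(1) unfolding faces_def by blast
  ultimately show "F \<in> faces G"
    unfolding faces_def using rest(1) sub(1) by (intro component_of_frontier_subset) auto
  have "verts G \<inter> frontier F \<subseteq> verts H"
    using rest(2) fr O(6) by blast
  then show "face_verts G F = face_verts H F"
    using sub(2) unfolding face_verts_def by blast
qed

lemma fum_coloring_copy_color_4:
  assumes H: "H_labelled k a b H" and k: "1 \<le> k"
    and sub: "point_set H \<subseteq> point_set G" "verts H \<subseteq> verts G" "edges H \<subseteq> edges G"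
    and rest: "point_set G \<subseteq> point_set H \<union> outer_face H" "verts G \<subseteq> verts H \<union> outer_face H"
    and c: "fum_coloring G c" "c ` verts G \<subseteq> {1..4}"
  shows "\<exists>i\<in>{1..3 * k + 1}. c (a i) = 4"
proof (rule H_labelled_outer_color_4[OF H k])
  show "proper_coloring H c"
    using c(1) sub unfolding fum_coloring_def proper_coloring_def adjacent_def by blast
  show "c ` verts H \<subseteq> {1, 2, 3, 4}"
  proof -
    have "{1..4} = {1, 2, 3, 4 :: nat}" by auto
    then show ?thesis using c(2) sub(2) by auto
  qed
  fix F assume "F \<in> interior_faces H"
  note F = interior_face_of_copy[OF H k sub(1,2) rest this]
  then show "unique_max_color H c F"
    using c(1) unfolding fum_coloring_def unique_max_color_def by metis
qed

text \<open>\<open>V\<close> is a neighborhood of \<open>x\<close>, and the complement of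
  \<open>e\<close> is dense, so neither the restriction to \<open>V\<close> nor the removal of
  \<open>e\<close> takes \<open>x\<close> out of the closure. In the joined graph this keeps the
  outer cycles on the frontier, including the ends of \<open>e\<close>.\<close>

lemma mem_closure_Int_Diff:
  assumes "x \<in> closure W" "open W" "open V" "x \<in> V" "interior e = {}"
  shows "x \<in> closure (W \<inter> V - e)"
proof -
  have "x \<in> closure (V \<inter> W)"
    using open_Int_closure_subset[OF assms(3), of W] assms(1,4) by blast
  moreover have "closure (- e) = UNIV"
    using assms(5) by (simp add: closure_complement)
  then have "V \<inter> W \<subseteq> closure (V \<inter> W \<inter> - e)"
    using open_Int_closure_subset[of "V \<inter> W" "- e"] assms(2,3) by auto
  then have "closure (V \<inter> W) \<subseteq> closure (V \<inter> W \<inter> - e)"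
    by (simp add: closure_minimal)
  ultimately show ?thesis by (auto simp: Int_commute Diff_eq)
qed

text \<open>Each copy forces a color 4 on its outer cycle, and the vertices of both outer cycles lie
  on the frontier of one face \<open>U\<close>, so the maximum there is not unique. The number of
  vertices later distinguishes the graphs for different \<open>k\<close>.\<close>

lemma G_graph_chi_fum:
  assumes G: "G_graph k G" and k: "1 \<le> k"
  shows "plane_graph G" "chi_fum G > 4" "card (verts G) = 2 * (6 * k + 2)"
proof -
  show pG: "plane_graph G" using G by (simp add: G_graph_def)
  obtain H H' a b a' b' e where H: "H_labelled k a b H" and H': "H_labelled k a' b' H'"
    and out: "point_set H \<subseteq> outer_face H'" "point_set H' \<subseteq> outer_face H"
    and e: "arc_between e (a 4) (a' 2)"
    and V: "verts G = verts H \<union> verts H'" and E: "edges G = insert e (edges H \<union> edges H')"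
    using G unfolding G_graph_def by (elim conjE exE) (rule that)
  note D = H_labelledD[OF H] and D' = H_labelledD[OF H']
  note O = H_labelled_outer_face_complement[OF H k] and O' = H_labelled_outer_face_complement[OF H' k]
  have VP: "verts H \<subseteq> point_set H" "verts H' \<subseteq> point_set H'" by (auto simp: point_set_def)
  have disj: "point_set H \<inter> point_set H' = {}" using out O(6) by blast
  show "card (verts G) = 2 * (6 * k + 2)"
  proof -
    have "card (verts G) = card (verts H) + card (verts H')"
      unfolding V using plane_graphD(1)[OF D(1)] plane_graphD(1)[OF D'(1)] disj VP
      by (intro card_Un_disjoint) auto
    then show ?thesis using H_labelled_card[OF H] H_labelled_card[OF H'] by simp
  qed
  have u: "a 4 \<in> verts H" using D(5) k by auto
  have v: "a' 2 \<in> verts H'" using D'(5) k by auto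
  have PG: "point_set G = point_set H \<union> point_set H' \<union> e"
    unfolding point_set_def V E by blast
  have eV: "e \<inter> verts G = {a 4, a' 2}"
    using u v E V by (intro plane_graph_edge_ends[OF pG _ e]) auto
  have ue: "a 4 \<in> e" and ve: "a' 2 \<in> e" using arc_between_ends[OF e] by auto
  \<comment> \<open>The joining edge contains \<open>a' 2\<close>, which no edge of the first copy
    does, so it differs from all of them and can meet them in vertices alone.\<close>
  have eH: "e \<inter> point_set H \<subseteq> {a 4}"
  proof -
    have "e \<inter> f \<subseteq> verts G" if "f \<in> edges H" for f
    proof -
      have "a' 2 \<notin> f" using v VP disj that unfolding point_set_def by blast
      then have "e \<noteq> f" using ve by blast
      then show ?thesis using plane_graphD(5)[OF pG, of e f] E that by blast
    qed
    then have "e \<inter> point_set H \<subseteq> {a 4, a' 2}"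
      unfolding eV[symmetric] using V by (auto simp: point_set_def)
    then show ?thesis using v VP disj by blast
  qed
  have eH': "e \<inter> point_set H' \<subseteq> {a' 2}"
  proof -
    have "e \<inter> f \<subseteq> verts G" if "f \<in> edges H'" for f
    proof -
      have "a 4 \<notin> f" using u VP disj that unfolding point_set_def by blast
      then have "e \<noteq> f" using ue by blast
      then show ?thesis using plane_graphD(5)[OF pG, of e f] E that by blast
    qed
    then have "e \<inter> point_set H' \<subseteq> {a 4, a' 2}"
      unfolding eV[symmetric] using V by (auto simp: point_set_def)
    then show ?thesis using u VP disj by blast
  qed
  have ne: "a 4 \<noteq> a' 2" using arc_between_ends[OF e] by blast
  \<comment> \<open>Away from \<open>a 4\<close> the joining edge is connected, avoids the first
    copy and reaches \<open>a' 2\<close>, which lies in the outer face of that copy.\<close>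
  have eO: "e - {a 4} \<subseteq> outer_face H"
  proof (rule components_maximal[OF O(4)[unfolded faces_def] arc_between_Diff_start_connected[OF e]])
    show "e - {a 4} \<subseteq> - point_set H" using eH by blast
    have "a' 2 \<in> outer_face H" using out(2) v VP by blast
    then show "outer_face H \<inter> (e - {a 4}) \<noteq> {}" using ve ne by auto
  qed
  have eO': "e - {a' 2} \<subseteq> outer_face H'"
  proof (rule components_maximal[OF O'(4)[unfolded faces_def]
        arc_between_Diff_start_connected[OF arc_between_sym[OF e]]])
    show "e - {a' 2} \<subseteq> - point_set H'" using eH' by blast
    have "a 4 \<in> outer_face H'" using out(1) u VP by blast
    then show "outer_face H' \<inter> (e - {a' 2}) \<noteq> {}" using ue ne by auto
  qed
  let ?S = "- outer_face H" and ?S' = "- outer_face H'"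
  have uS: "a 4 \<in> ?S" "a' 2 \<in> ?S'" using u v VP O(6) O'(6) by blast+
  \<comment> \<open>The disc of the first copy is connected, avoids the second copy and contains
    \<open>a 4\<close>, so it falls into the outer face of the second; hence the two discs are
    disjoint.\<close>
  have SO': "?S \<subseteq> outer_face H'"
  proof (rule components_maximal[OF O'(4)[unfolded faces_def] O(2)])
    show "?S \<subseteq> - point_set H'" using out(2) by blast
    have "a 4 \<in> outer_face H'" using out(1) u VP by blast
    then show "outer_face H' \<inter> ?S \<noteq> {}" using uS(1) by blast
  qed
  define U where "U = outer_face H \<inter> outer_face H' - e"
  have U_eq: "- U = (?S \<union> e) \<union> ?S'" unfolding U_def by blast
  have ce: "compact e" using arc_between_connected_compact[OF e] by blast
  \<comment> \<open>Two applications of Janiszewski's theorem: the arc meets the first disc only in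
    \<open>a 4\<close>, and the union of both meets the second disc only in \<open>a' 2\<close>. A
    single point is connected.\<close>
  have conn1: "connected (- (?S \<union> e))"
  proof (rule Janiszewski_connected)
    have "?S \<inter> e = {a 4}" using eO uS ue by blast
    then show "connected (?S \<inter> e)" by simp
  qed (use O(1,3) ce arc_between_complement_connected[OF e] in \<open>auto intro: compact_imp_closed\<close>)
  have "connected (- ((?S \<union> e) \<union> ?S'))"
  proof (rule Janiszewski_connected)
    have "(?S \<union> e) \<inter> ?S' = {a' 2}" using eO' uS ve SO' by blast
    then show "connected ((?S \<union> e) \<inter> ?S')" by simp
    show "compact (?S \<union> e)" using O(1) ce by (rule compact_Un)
    show "closed ?S'" using O'(1) by (rule compact_imp_closed)
    show "connected (- ?S')" using O'(3) by simp
  qed (rule conn1)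
  then have connU: "connected U" unfolding U_eq[symmetric] by simp
  have "bounded (- U)"
    unfolding U_eq using O(1) O'(1) ce by (simp add: compact_imp_bounded)
  then have ubU: "\<not> bounded U" by (rule cobounded_imp_unbounded)
  have "frontier U = frontier ((?S \<union> e) \<union> ?S')"
    unfolding U_eq[symmetric] by simp
  also have "\<dots> \<subseteq> (frontier ?S \<union> frontier e) \<union> frontier ?S'"
    using frontier_Un_subset[of "?S \<union> e" ?S'] frontier_Un_subset[of ?S e] by blast
  also have "\<dots> \<subseteq> point_set G"
    using O(5) O'(5) frontier_subset_compact[OF ce] unfolding PG by auto
  finally have "frontier U \<subseteq> point_set G" .
  moreover have "U \<inter> point_set G = {}"
    using O(6) O'(6) unfolding PG U_def by blast
  moreover have "U \<noteq> {}" using ubU by auto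
  ultimately have UF: "U \<in> faces G"
    unfolding faces_def using connU by (intro component_of_frontier_subset) auto
  have ie: "interior e = {}" by (rule arc_between_interior_empty[OF e])
  have A: "a i \<in> face_verts G U" if "i \<in> {1..3 * k + 1}" for i
  proof -
    have ai: "a i \<in> frontier (outer_face H)" "a i \<in> verts H" using O(7) D(5) that by auto
    then have "a i \<in> closure U"
      unfolding U_def using out(1) VP O(8) O'(8) ie
      by (intro mem_closure_Int_Diff) (auto simp: frontier_def)
    moreover have "a i \<notin> U" using ai(2) VP O(6) unfolding U_def by blast
    ultimately show ?thesis
      using ai(2) V interior_subset[of U] unfolding face_verts_def frontier_def by blast
  qed
  have A': "a' i \<in> face_verts G U" if "i \<in> {1..3 * k + 1}" for i
  proof -
    have ai: "a' i \<in> frontier (outer_face H')" "a' i \<in> verts H'" using O'(7) D'(5) that by auto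
    have U_sym: "U = outer_face H' \<inter> outer_face H - e" unfolding U_def by blast
    have "a' i \<in> closure U"
      unfolding U_sym using ai out(2) VP O(8) O'(8) ie
      by (intro mem_closure_Int_Diff) (auto simp: frontier_def)
    moreover have "a' i \<notin> U" using ai(2) VP O'(6) unfolding U_def by blast
    ultimately show ?thesis
      using ai(2) V interior_subset[of U] unfolding face_verts_def frontier_def by blast
  qed
  show "chi_fum G > 4"
  proof (rule chi_fum_greaterI[OF pG])
    fix c assume c: "fum_coloring G c" "c ` verts G \<subseteq> {1..4}"
    obtain i where i: "i \<in> {1..3 * k + 1}" "c (a i) = 4"
      using fum_coloring_copy_color_4[OF H k _ _ _ _ _ c] PG V E VP out(2) eO u by blast
    obtain j where j: "j \<in> {1..3 * k + 1}" "c (a' j) = 4"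
      using fum_coloring_copy_color_4[OF H' k _ _ _ _ _ c] PG V E VP out(1) eO' v by blast
    have "c ` face_verts G U \<subseteq> {..4}" "finite (face_verts G U)"
      using c(2) plane_graphD(1)[OF pG] unfolding face_verts_def by auto
    moreover have "4 \<in> c ` face_verts G U" using A[OF i(1)] i(2) by force
    ultimately have "Max (c ` face_verts G U) = 4"
      by (intro Max_eqI) auto
    moreover have "unique_max_color G c U" using c(1) UF unfolding fum_coloring_def by blast
    ultimately have "a i = a' j"
      using A[OF i(1)] A'[OF j(1)] i(2) j(2) unfolding unique_max_color_def by auto
    moreover have "a i \<in> point_set H" "a' j \<in> point_set H'"
      using i(1) j(1) D(5) D'(5) VP by blast+
    ultimately show False using disj by auto
  qed
qed

section \<open>Drawings of \<open>H\<^sub>k\<close> and of the joined graphs\<close>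

datatype edge_kind = Outer | Inner | Down | Up

text \<open>
  The drawing lives in the annulus of radii 1 and 2 around \<open>p\<close>: \<open>polar s t\<close> has radius \<open>1 + s\<close>, and
  its angle is \<open>t\<close> measured in \<open>n\<close>-ths of a full turn, starting at the direction \<open>\<rho>\<close>.
\<close>

locale annulus_drawing =
  fixes k :: nat and p \<rho> :: complex
  assumes k: "1 \<le> k" and norm_\<rho>: "norm \<rho> = 1"
begin

definition n :: nat where "n = 3 * k + 1"

definition polar :: "real \<Rightarrow> real \<Rightarrow> complex" where
  "polar s t = p + \<rho> * of_real (1 + s) * cis (2 * pi * t / n)"

text \<open>Inner vertices sit half a step ahead of the outer ones. A \<open>Down\<close> edge
  spirals inward from \<open>a i\<close> to \<open>b i\<close> and an \<open>Up\<close> edge outward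
  from \<open>b i\<close> to the next outer vertex, each covering half a step of angle.\<close>

fun curve :: "edge_kind \<Rightarrow> nat \<Rightarrow> real \<Rightarrow> complex" where
  "curve Outer i x = polar 1 (real i + x)"
| "curve Inner i x = polar 0 (real i + 1/2 + x)"
| "curve Down i x = polar (1 - x) (real i + x / 2)"
| "curve Up i x = polar x (real i + 1/2 + x / 2)"

definition a :: "nat \<Rightarrow> complex" where "a i = polar 1 (real i)"
definition b :: "nat \<Rightarrow> complex" where "b i = polar 0 (real i + 1/2)"

definition H :: plane_drawing where
  "H = \<lparr>verts = a ` {1..n} \<union> b ` {1..n}, 
    edges = (\<lambda>i. path_image (curve Outer i)) ` {1..n} \<union> (\<lambda>i. path_image (curve Inner i)) ` {1..n} \<union>
      (\<lambda>i. path_image (curve Down i)) ` {1..n} \<union> (\<lambda>i. path_image (curve Up i)) ` {1..n}\<rparr>"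

lemma edges_HE:
  assumes "e \<in> edges H"
  obtains \<kappa> i where "e = path_image (curve \<kappa> i)" "i \<in> {1..n}"
  using assms unfolding H_def plane_drawing.simps by (elim UnE imageE) (rule that; assumption)+

section \<open>Polar coordinates modulo full turns\<close>

lemma n_pos: "4 \<le> n" using k by (simp add: n_def)

lemma dist_polar: "0 \<le> s \<Longrightarrow> dist p (polar s t) = 1 + s"
  by (simp add: polar_def dist_norm norm_mult norm_\<rho> del: of_real_add)

lemma polar_eq_iff:
  assumes "0 \<le> s" "0 \<le> s'"
  shows "polar s t = polar s' t' \<longleftrightarrow> s = s' \<and> (\<exists>m::int. t = t' + of_int m * real n)"
proof
  assume eq: "polar s t = polar s' t'"
  then have s: "s = s'"
    using dist_polar[OF assms(1), of t] dist_polar[OF assms(2), of t'] by simp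
  moreover have "\<rho> \<noteq> 0" "complex_of_real (1 + s) \<noteq> 0"
    using norm_\<rho> assms(1) by (auto simp del: of_real_add)
  ultimately have "cis (2 * pi * t / n) = cis (2 * pi * t' / n)"
    using eq by (simp add: polar_def del: of_real_add)
  then have "\<exists>m::int. 2 * pi * t / n = 2 * pi * t' / n + 2 * pi * m"
    using sin_cos_eq_iff[of "2 * pi * t / n" "2 * pi * t' / n"] by (simp add: complex_eq_iff)
  then obtain m :: int where "2 * pi * t / n = 2 * pi * t' / n + 2 * pi * m" by blast
  then have "2 * pi * t = 2 * pi * (t' + of_int m * real n)" using n_pos by (simp add: field_simps)
  then have "t = t' + of_int m * real n" by (subst (asm) mult_left_cancel) auto
  then show "s = s' \<and> (\<exists>m::int. t = t' + of_int m * real n)" using s by blast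
next
  assume "s = s' \<and> (\<exists>m::int. t = t' + of_int m * real n)"
  then obtain m :: int where m: "s = s'" "t = t' + of_int m * real n" by blast
  have "2 * pi * t / n = 2 * pi * t' / n + 2 * pi * m"
    using n_pos m(2) by (simp add: field_simps)
  then have "cis (2 * pi * t / n) = cis (2 * pi * t' / n)"
    using sin_cos_eq_iff[of "2 * pi * t / n" "2 * pi * t' / n"] by (auto simp: complex_eq_iff)
  then show "polar s t = polar s' t'" using m(1) by (simp add: polar_def)
qed

lemma polar_eqD:
  assumes "0 \<le> s" "0 \<le> s'" "polar s t = polar s' t'"
  shows "s = s'" "\<exists>m::int. t = t' + of_int m * real n"
  using assms polar_eq_iff by blast+

text \<open>The quantity in the bound is an integer, so it vanishes; then \<open>m * n\<close> is a
  difference of two indices and smaller than \<open>n\<close> in absolute value, which forces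
  \<open>m = 0\<close>.\<close>

lemma index_eqI:
  assumes "i \<in> {1..n}" "j \<in> {1..n}" "\<bar>real i - real j - of_int m * real n\<bar> < 1"
  shows "i = j" "m = 0"
proof -
  have "real i - real j - of_int m * real n = of_int (int i - int j - m * int n)" by simp
  then have "\<bar>int i - int j - m * int n\<bar> < 1"
    using assms(3) by (metis of_int_abs of_int_less_1_iff)
  then have eq: "int i - int j = m * int n" by simp
  have "\<bar>m * int n\<bar> < 1 * int n" using assms(1,2) unfolding eq[symmetric] by auto
  then have "\<bar>m\<bar> * int n < 1 * int n" by (simp add: abs_mult)
  then have "\<bar>m\<bar> < 1" using mult_less_cancel_right_pos[of "int n"] n_pos by simp
  then show "m = 0" by simp
  then show "i = j" using eq by simp
qed

lemma polar_nxt: "i \<in> {1..n} \<Longrightarrow> polar s (real (nxt k i) + r) = polar s (real i + 1 + r)"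
proof (cases "i = n")
  case True
  have "2 * pi * (real n + 1 + r) / n = 2 * pi * (1 + r) / n + 2 * pi"
    using n_pos by (simp add: field_simps)
  then have "cis (2 * pi * (real n + 1 + r) / n) = cis (2 * pi * (1 + r) / n)"
    by (simp add: complex_eq_iff)
  then show ?thesis using True by (simp add: polar_def nxt_def n_def)
qed (simp add: nxt_def n_def add.commute add.left_commute)

lemma curve_0:
  "curve Outer i 0 = a i" "curve Inner i 0 = b i" "curve Down i 0 = a i" "curve Up i 0 = b i"
  by (simp_all add: a_def b_def)

lemma curve_1:
  assumes "i \<in> {1..n}"
  shows "curve Outer i 1 = a (nxt k i)" "curve Inner i 1 = b (nxt k i)"
    "curve Down i 1 = b i" "curve Up i 1 = a (nxt k i)"
  using polar_nxt[OF assms, of 1 0] polar_nxt[OF assms, of 0 "1/2"]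
  by (simp_all add: a_def b_def algebra_simps)

lemma nxt_mem: "i \<in> {1..n} \<Longrightarrow> nxt k i \<in> {1..n}"
  using nxt_in[of i k] by (simp add: n_def)

section \<open>Incidences of the drawn vertices and edges\<close>

lemma curve_ends_verts:
  assumes "i \<in> {1..n}"
  shows "curve \<kappa> i 0 \<in> verts H" "curve \<kappa> i 1 \<in> verts H"
  using assms nxt_mem[OF assms] curve_0[of i] curve_1[OF assms]
  by (cases \<kappa>; simp add: H_def del: curve.simps)+

lemma inj_a: "inj_on a {1..n}"
proof (rule inj_onI)
  fix i j assume ij: "i \<in> {1..n}" "j \<in> {1..n}" "a i = a j"
  then obtain m :: int where "real i = real j + of_int m * real n"
    by (auto simp: a_def polar_eq_iff)
  then show "i = j" using index_eqI(1)[OF ij(1,2), of m] by simp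
qed

lemma inj_b: "inj_on b {1..n}"
proof (rule inj_onI)
  fix i j assume ij: "i \<in> {1..n}" "j \<in> {1..n}" "b i = b j"
  then obtain m :: int where "real i = real j + of_int m * real n"
    by (auto simp: b_def polar_eq_iff)
  then show "i = j" using index_eqI(1)[OF ij(1,2), of m] by simp
qed

lemma a_neq_b: "a i \<noteq> b j" "b j \<noteq> a i"
  by (auto simp: a_def b_def polar_eq_iff)

lemma curve_interior_not_vert:
  assumes "i \<in> {1..n}" "0 < x" "x < 1"
  shows "curve \<kappa> i x \<notin> verts H"
proof
  assume "curve \<kappa> i x \<in> verts H"
  then obtain j where j: "j \<in> {1..n}" "curve \<kappa> i x = a j \<or> curve \<kappa> i x = b j"
    by (auto simp: H_def simp del: curve.simps)
  \<comment> \<open>On \<open>Outer\<close> and \<open>Inner\<close> edges the angle rules out a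
    vertex of the same circle; on \<open>Down\<close> and \<open>Up\<close> edges the radius lies
    strictly between those of the circles.\<close>
  have no: "real i + x \<noteq> real j + of_int m * real n" for m :: int
  proof
    assume eq: "real i + x = real j + of_int m * real n"
    then have "i = j" "m = 0" using index_eqI[OF assms(1) j(1), of m] assms by auto
    then show False using eq assms by simp
  qed
  show False
    using j(2) assms no by (cases \<kappa>) (auto simp: a_def b_def polar_eq_iff)
qed

text \<open>For kinds that can share a radius, the angles agree up to full turns. After inserting
  the relation between \<open>x\<close> and \<open>y\<close> given by the radius, they differ by
  less than one step, so \<open>D\<close> applies. A \<open>Down\<close> and an \<open>Up\<close>
  edge would need the nonzero offset \<open>x - 1\<close> or \<open>x\<close> to vanish; other mixed
  pairs have different radii.\<close>

lemma curve_interior_inj: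
  assumes ij: "i \<in> {1..n}" "j \<in> {1..n}" and x: "0 < x" "x < 1" and y: "0 < y" "y < 1"
    and eq: "curve \<kappa> i x = curve \<mu> j y"
  shows "\<kappa> = \<mu> \<and> i = j"
proof -
  have D: "i = j \<and> r = 0" if "real i + r = real j + of_int m * real n" "\<bar>r\<bar> < 1" for r and m :: int
  proof -
    have "\<bar>real i - real j - of_int m * real n\<bar> < 1"
      using that by (simp add: algebra_simps abs_minus_commute)
    then have "i = j" "m = 0" using index_eqI[OF ij] by blast+
    then show ?thesis using that by simp
  qed
  have nn: "0 \<le> x" "0 \<le> y" "0 \<le> 1 - x" "0 \<le> 1 - y" using x y by auto
  show ?thesis
  proof (cases \<kappa>; cases \<mu>)
    assume kinds: "\<kappa> = Outer" "\<mu> = Outer"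
    then have "polar 1 (real i + x) = polar 1 (real j + y)"
      using eq by simp
    note E = polar_eqD[OF zero_le_one zero_le_one this]
    from E(2) obtain m :: int where "real i + x = real j + y + of_int m * real n" by blast
    then show ?thesis using D[of "x - y" m] E(1) x y kinds by (auto simp: abs_if field_simps)
  next
    assume kinds: "\<kappa> = Inner" "\<mu> = Inner"
    then have "polar 0 (real i + 1/2 + x) = polar 0 (real j + 1/2 + y)"
      using eq by simp
    note E = polar_eqD[OF order.refl order.refl this]
    from E(2) obtain m :: int where "real i + 1/2 + x = real j + 1/2 + y + of_int m * real n" by blast
    then show ?thesis using D[of "x - y" m] E(1) x y kinds by (auto simp: abs_if field_simps)
  next
    assume kinds: "\<kappa> = Down" "\<mu> = Down"
    then have "polar (1 - x) (real i + x / 2) = polar (1 - y) (real j + y / 2)"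
      using eq by simp
    note E = polar_eqD[OF nn(3) nn(4) this]
    from E(2) obtain m :: int where "real i + x / 2 = real j + y / 2 + of_int m * real n" by blast
    then show ?thesis using D[of "0" m] E(1) x y kinds by (auto simp: abs_if field_simps)
  next
    assume kinds: "\<kappa> = Up" "\<mu> = Up"
    then have "polar x (real i + 1/2 + x / 2) = polar y (real j + 1/2 + y / 2)"
      using eq by simp
    note E = polar_eqD[OF nn(1) nn(2) this]
    from E(2) obtain m :: int where "real i + 1/2 + x / 2 = real j + 1/2 + y / 2 + of_int m * real n" by blast
    then show ?thesis using D[of "0" m] E(1) x y kinds by (auto simp: abs_if field_simps)
  next
    assume kinds: "\<kappa> = Down" "\<mu> = Up"
    then have "polar (1 - x) (real i + x / 2) = polar y (real j + 1/2 + y / 2)"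
      using eq by simp
    note E = polar_eqD[OF nn(3) nn(2) this]
    from E(2) obtain m :: int where "real i + x / 2 = real j + 1/2 + y / 2 + of_int m * real n" by blast
    then show ?thesis using D[of "x - 1" m] E(1) x y kinds by (auto simp: abs_if field_simps)
  next
    assume kinds: "\<kappa> = Up" "\<mu> = Down"
    then have "polar x (real i + 1/2 + x / 2) = polar (1 - y) (real j + y / 2)"
      using eq by simp
    note E = polar_eqD[OF nn(1) nn(4) this]
    from E(2) obtain m :: int where "real i + 1/2 + x / 2 = real j + y / 2 + of_int m * real n" by blast
    then show ?thesis using D[of "x" m] E(1) x y kinds by (auto simp: abs_if field_simps)
  qed (use eq x y in \<open>auto simp: polar_eq_iff\<close>)
qed

lemma continuous_on_polar:
  assumes "continuous_on S f" "continuous_on S g"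
  shows "continuous_on S (\<lambda>x. polar (f x) (g x))"
  unfolding polar_def using assms n_pos by (intro continuous_intros) auto

text \<open>On the circles the angles of two points of one edge differ by at most 1, less than a
  full turn of \<open>n\<close> units; on \<open>Down\<close> and \<open>Up\<close> edges the radius
  alone determines the parameter.\<close>

lemma curve_inj:
  assumes "x \<in> {0..1}" "y \<in> {0..1}" "curve \<kappa> i x = curve \<kappa> i y"
  shows "x = y"
proof -
  have D: "r = 0" if "r = of_int m * real n" "\<bar>r\<bar> \<le> 1" for r and m :: int
  proof -
    have "\<bar>m\<bar> * int n < 1 * int n"
    proof -
      have "real_of_int (\<bar>m\<bar> * int n) \<le> 1" using that by (simp add: abs_mult)
      then have "\<bar>m\<bar> * int n \<le> 1" by (simp only: of_int_le_1_iff)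
      also have "1 < 1 * int n" using n_pos by simp
      finally show ?thesis .
    qed
    then have "\<bar>m\<bar> < 1" using mult_less_cancel_right_pos[of "int n"] n_pos by simp
    then show ?thesis using that by simp
  qed
  have xy: "\<bar>x - y\<bar> \<le> 1" using assms by auto
  show ?thesis
  proof (cases \<kappa>)
    case Outer
    then have "polar 1 (real i + x) = polar 1 (real i + y)" using assms by simp
    from polar_eqD(2)[OF zero_le_one zero_le_one this]
    obtain m :: int where "real i + x = real i + y + of_int m * real n" by blast
    then show ?thesis using D[of "x - y" m] xy by simp
  next
    case Inner
    then have "polar 0 (real i + 1/2 + x) = polar 0 (real i + 1/2 + y)" using assms by simp
    from polar_eqD(2)[OF order.refl order.refl this]
    obtain m :: int where "real i + 1/2 + x = real i + 1/2 + y + of_int m * real n" by blast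
    then show ?thesis using D[of "x - y" m] xy by simp
  qed (use assms in \<open>auto simp: polar_eq_iff\<close>)
qed

lemma arc_curve: "arc (curve \<kappa> i)"
proof -
  have "continuous_on {0..1} (curve \<kappa> i)"
    by (cases \<kappa>) (auto intro!: continuous_on_polar continuous_intros simp: curve.simps[abs_def])
  then show ?thesis
    unfolding arc_def path_def inj_on_def using curve_inj by blast
qed

lemma arc_between_curve: "arc_between (path_image (curve \<kappa> i)) (curve \<kappa> i 0) (curve \<kappa> i 1)"
  unfolding arc_between_def pathstart_def pathfinish_def using arc_curve by blast

lemma path_image_curveE:
  assumes "z \<in> path_image (curve \<kappa> i)"
  obtains "z = curve \<kappa> i 0" | "z = curve \<kappa> i 1" | x where "0 < x" "x < 1" "z = curve \<kappa> i x"
proof -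
  obtain x where "x \<in> {0..1}" "z = curve \<kappa> i x" using assms unfolding path_image_def by blast
  moreover from this consider "x = 0" | "x = 1" | "0 < x" "x < 1" by fastforce
  ultimately show thesis using that by cases blast+
qed

lemma curve_Int_verts:
  assumes "i \<in> {1..n}"
  shows "path_image (curve \<kappa> i) \<inter> verts H = {curve \<kappa> i 0, curve \<kappa> i 1}"
proof
  show "path_image (curve \<kappa> i) \<inter> verts H \<subseteq> {curve \<kappa> i 0, curve \<kappa> i 1}"
    using curve_interior_not_vert[OF assms] by (auto elim!: path_image_curveE)
  show "{curve \<kappa> i 0, curve \<kappa> i 1} \<subseteq> path_image (curve \<kappa> i) \<inter> verts H"
    using curve_ends_verts[OF assms] by (auto simp: path_image_def)
qed

text \<open>This excludes parallel edges. Most kinds are told apart by the cycles containing the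
  ends; otherwise it matters that no index is its own successor and no two are each other's
  successors.\<close>

lemma curve_ends_inj:
  assumes "i \<in> {1..n}" "j \<in> {1..n}" "{curve \<kappa> i 0, curve \<kappa> i 1} = {curve \<mu> j 0, curve \<mu> j 1}"
  shows "\<kappa> = \<mu> \<and> i = j"
proof -
  note I = assms(1,2) nxt_mem[OF assms(1)] nxt_mem[OF assms(2)]
  have nx: "nxt k i \<noteq> i" "nxt k j \<noteq> j" "\<not> (nxt k i = j \<and> nxt k j = i)"
    using k by (auto simp: nxt_def)
  show ?thesis
    using assms(3) I nx
    by (cases \<kappa>; cases \<mu>)
      (auto simp: curve_0 curve_1[OF assms(1)] curve_1[OF assms(2)] doubleton_eq_iff a_neq_b
        inj_on_eq_iff[OF inj_a] inj_on_eq_iff[OF inj_b] simp del: curve.simps)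
qed

lemma plane_graph_H: "plane_graph H"
  unfolding plane_graph_def
proof (intro conjI ballI impI)
  show "finite (verts H)" "verts H \<noteq> {}" using n_pos by (auto simp: H_def)
  show "finite (edges H)" by (simp add: H_def)
next
  fix e assume "e \<in> edges H"
  then obtain \<kappa> i where e: "e = path_image (curve \<kappa> i)" "i \<in> {1..n}" by (rule edges_HE)
  then show "\<exists>u v. arc_between e u v \<and> e \<inter> verts H = {u, v}"
    using arc_between_curve[of \<kappa> i] curve_Int_verts[OF e(2), of \<kappa>] by blast
next
  fix e e' assume E: "e \<in> edges H" "e' \<in> edges H" "e \<noteq> e'"
  obtain \<kappa> i where e: "e = path_image (curve \<kappa> i)" "i \<in> {1..n}" using E(1) by (rule edges_HE)
  obtain \<mu> j where e': "e' = path_image (curve \<mu> j)" "j \<in> {1..n}" using E(2) by (rule edges_HE)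
  have ne: "\<not> (\<kappa> = \<mu> \<and> i = j)" using e e' E by blast
  then show "e \<inter> verts H \<noteq> e' \<inter> verts H"
    using curve_ends_inj[OF e(2) e'(2), of \<kappa> \<mu>] curve_Int_verts e e' by metis
  show "e \<inter> e' \<subseteq> verts H"
  proof
    fix z assume "z \<in> e \<inter> e'"
    then have z: "z \<in> path_image (curve \<kappa> i)" "z \<in> path_image (curve \<mu> j)" using e e' by auto
    show "z \<in> verts H"
    proof (rule ccontr)
      assume "z \<notin> verts H"
      then obtain x y where "0 < x" "x < 1" "z = curve \<kappa> i x" "0 < y" "y < 1" "z = curve \<mu> j y"
        using z curve_ends_verts[OF e(2), of \<kappa>] curve_ends_verts[OF e'(2), of \<mu>]
        by (auto elim!: path_image_curveE)
      then show False using curve_interior_inj[OF e(2) e'(2), of x y \<kappa> \<mu>] ne by simp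
    qed
  qed
qed

section \<open>The two cycles as concentric circles\<close>

text \<open>The angle of \<open>z\<close>, with the offset \<open>c\<close> removed, is shifted by
  full turns into the range from 1 to below \<open>n + 1\<close>, then split into the index
  \<open>i\<close> and the fractional part \<open>x\<close>. The offset is 0 for the outer and 1/2
  for the inner circle.\<close>

lemma sphere_polar:
  assumes "0 \<le> s" "z \<in> sphere p (1 + s)"
  obtains i x where "i \<in> {1..n}" "x \<in> {0..1}" "z = polar s (real i + c + x)"
proof -
  define w where "w = (z - p) / (\<rho> * of_real (1 + s))"
  have nz: "\<rho> * of_real (1 + s) \<noteq> 0"
    using norm_\<rho> assms(1) by (auto simp del: of_real_add)
  have "norm w = 1"
    using assms nz norm_\<rho> by (simp add: w_def norm_divide norm_mult dist_norm norm_minus_commute del: of_real_add)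
  then have w: "w = cis (Arg w)"
    using cis_Arg[of w] by (cases "w = 0") (auto simp: sgn_div_norm)
  define t where "t = real n * Arg w / (2 * pi)"
  have "2 * pi * t / n = Arg w" using n_pos by (simp add: t_def)
  then have zt: "z = polar s t"
    using w nz by (simp add: polar_def w_def field_simps del: of_real_add)
  define m :: int where "m = - \<lfloor>(t - c - 1) / real n\<rfloor>"
  define t' where "t' = t - c + of_int m * real n"
  have "t' - 1 = real n * frac ((t - c - 1) / real n)"
    using n_pos by (simp add: t'_def m_def frac_def field_simps)
  moreover have "0 \<le> frac ((t - c - 1) / real n)" "frac ((t - c - 1) / real n) < 1"
    by (simp_all add: frac_lt_1)
  moreover have "0 \<le> real n * frac ((t - c - 1) / real n)" by simp
  moreover have "real n * frac ((t - c - 1) / real n) < real n * 1"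
    using n_pos frac_lt_1 by (intro mult_strict_left_mono) auto
  ultimately have t': "1 \<le> t'" "t' < real n + 1" by linarith+
  have "polar s t = polar s (t' + c)"
    using assms(1) by (subst polar_eq_iff) (auto simp: t'_def intro!: exI[of _ "- m"])
  moreover have "t' = real (nat \<lfloor>t'\<rfloor>) + frac t'"
    using t' by (simp add: frac_def)
  ultimately have "z = polar s (real (nat \<lfloor>t'\<rfloor>) + c + frac t')"
    using zt by (metis add.assoc add.commute)
  moreover have "nat \<lfloor>t'\<rfloor> \<in> {1..n}"
    using t' by (auto simp: le_nat_iff nat_le_iff le_floor_iff floor_le_iff)
  moreover have "frac t' \<in> {0..1}" using frac_lt_1[of t'] by (simp add: less_imp_le)
  ultimately show thesis using that by blast
qed

lemma Union_Outer: "(\<Union>i\<in>{1..n}. path_image (curve Outer i)) = sphere p 2"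
proof
  show "sphere p 2 \<subseteq> (\<Union>i\<in>{1..n}. path_image (curve Outer i))"
  proof
    fix z assume "z \<in> sphere p 2"
    then obtain i x where "i \<in> {1..n}" "x \<in> {0..1}" "z = polar 1 (real i + x)"
      using sphere_polar[of 1 z 0] by auto
    then have "z \<in> path_image (curve Outer i)"
      unfolding path_image_def by (intro image_eqI[of _ _ x]) auto
    then show "z \<in> (\<Union>i\<in>{1..n}. path_image (curve Outer i))" using \<open>i \<in> {1..n}\<close> by blast
  qed
qed (auto simp: path_image_def dist_polar)

lemma Union_Inner: "(\<Union>i\<in>{1..n}. path_image (curve Inner i)) = sphere p 1"
proof
  show "sphere p 1 \<subseteq> (\<Union>i\<in>{1..n}. path_image (curve Inner i))"
  proof
    fix z assume "z \<in> sphere p 1"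
    then obtain i x where "i \<in> {1..n}" "x \<in> {0..1}" "z = polar 0 (real i + 1/2 + x)"
      using sphere_polar[of 0 z "1/2"] by auto
    then have "z \<in> path_image (curve Inner i)"
      unfolding path_image_def by (intro image_eqI[of _ _ x]) auto
    then show "z \<in> (\<Union>i\<in>{1..n}. path_image (curve Inner i))" using \<open>i \<in> {1..n}\<close> by blast
  qed
qed (auto simp: path_image_def dist_polar)

lemma inside_sphere: "inside (sphere p 2) = ball p 2"
  using inside_frontier_eq_interior[of "cball p 2"] by (simp add: frontier_cball interior_cball)

lemma outside_sphere: "outside (sphere p 1) = - cball p 1"
  using outside_frontier_eq_complement_closure[of "cball p 1"] by (simp add: frontier_cball)

lemma curve_interior_annulus:
  assumes "z \<in> path_image (curve \<kappa> i)" "z \<noteq> curve \<kappa> i 0" "z \<noteq> curve \<kappa> i 1" "\<kappa> = Down \<or> \<kappa> = Up"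
  shows "z \<in> ball p 2 \<inter> - cball p 1"
proof -
  obtain x where "0 < x" "x < 1" "z = curve \<kappa> i x"
    using assms path_image_curveE by metis
  then show ?thesis using assms(4) by (auto simp: dist_polar)
qed

lemma H_labelled_H: "H_labelled k a b H"
  unfolding H_labelled_def Let_def n_def[symmetric]
proof (intro conjI exI)
  show "plane_graph H" "inj_on a {1..n}" "inj_on b {1..n}" "a ` {1..n} \<inter> b ` {1..n} = {}"
    "verts H = a ` {1..n} \<union> b ` {1..n}"
    using plane_graph_H inj_a inj_b a_neq_b by (auto simp: H_def)
  let ?e = "\<lambda>\<kappa> i. path_image (curve \<kappa> i)"
  show "edges H = ?e Outer ` {1..n} \<union> ?e Inner ` {1..n} \<union> ?e Down ` {1..n} \<union> ?e Up ` {1..n}"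
    by (simp add: H_def)
  show "\<forall>i\<in>{1..n}. arc_between (?e Outer i) (a i) (a (nxt k i)) \<and>
      arc_between (?e Inner i) (b i) (b (nxt k i)) \<and>
      arc_between (?e Down i) (a i) (b i) \<and> arc_between (?e Up i) (b i) (a (nxt k i))"
    using arc_between_curve curve_0 curve_1 by metis
  show "\<Union> (?e Inner ` {1..n}) \<subseteq> inside (\<Union> (?e Outer ` {1..n}))"
    unfolding Union_Outer Union_Inner inside_sphere by auto
  show "\<forall>i\<in>{1..n}. ?e Down i - {a i, b i} \<subseteq>
      inside (\<Union> (?e Outer ` {1..n})) \<inter> outside (\<Union> (?e Inner ` {1..n}))"
    unfolding Union_Outer Union_Inner inside_sphere outside_sphere
    using curve_interior_annulus[of _ Down] curve_0(3) curve_1(3) by blast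
  show "\<forall>i\<in>{1..n}. ?e Up i - {b i, a (nxt k i)} \<subseteq>
      inside (\<Union> (?e Outer ` {1..n})) \<inter> outside (\<Union> (?e Inner ` {1..n}))"
    unfolding Union_Outer Union_Inner inside_sphere outside_sphere
    using curve_interior_annulus[of _ Up] curve_0(4) curve_1(4) by blast
qed

lemma point_set_H: "sphere p 2 \<subseteq> point_set H" "point_set H \<subseteq> cball p 2"
proof -
  show "sphere p 2 \<subseteq> point_set H"
    unfolding Union_Outer[symmetric] point_set_def by (auto simp: H_def simp del: curve.simps)
  have "curve \<kappa> i x \<in> cball p 2" if "x \<in> {0..1}" for \<kappa> i x
    using that by (cases \<kappa>) (auto simp: dist_polar)
  moreover have "a i \<in> cball p 2" "b i \<in> cball p 2" for i
    by (auto simp: a_def b_def dist_polar)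
  ultimately show "point_set H \<subseteq> cball p 2"
    by (auto simp: point_set_def H_def path_image_def simp del: curve.simps mem_cball)
qed

lemma outer_face_H: "outer_face H = - cball p 2"
proof (rule outer_face_eqI)
  show "bounded (point_set H)" using point_set_H(2) bounded_cball bounded_subset by blast
  have "\<not> bounded (- cball p 2)"
    by (intro cobounded_imp_unbounded) simp
  moreover have "connected (- cball p 2)"
    by (intro connected_complement_bounded_convex) auto
  ultimately show "- cball p 2 \<in> faces H" "\<not> bounded (- cball p 2)"
    unfolding faces_def using point_set_H
    by (auto intro!: component_of_frontier_subset simp: frontier_complement frontier_cball
        simp del: mem_cball mem_sphere)
qed

end

section \<open>Existence of the graphs and the joining of two drawings\<close>

lemma H_graph_exists: "1 \<le> k \<Longrightarrow> \<exists>H. H_graph k H"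
proof -
  assume "1 \<le> k"
  then interpret annulus_drawing k 0 1 by unfold_locales auto
  show ?thesis using H_labelled_H unfolding H_graph_def by blast
qed

text \<open>The new edge has a vertex in each copy, which separates its vertex set from those of all
  old edges; edges of different copies are disjoint, and edges of the same copy inherit the
  conditions.\<close>

lemma plane_graph_join:
  assumes H: "plane_graph H" and H': "plane_graph H'" and disj: "point_set H \<inter> point_set H' = {}"
    and e: "arc_between e u v" and uv: "u \<in> verts H" "v \<in> verts H'"
    and eH: "e \<inter> point_set H = {u}" "e \<inter> point_set H' = {v}"
  shows "plane_graph \<lparr>verts = verts H \<union> verts H', edges = insert e (edges H \<union> edges H')\<rparr>"
    (is "plane_graph ?G")
proof -
  have VP: "verts H \<subseteq> point_set H" "verts H' \<subseteq> point_set H'" by (auto simp: point_set_def)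
  have EP: "f \<in> edges H \<Longrightarrow> f \<subseteq> point_set H" "f \<in> edges H' \<Longrightarrow> f \<subseteq> point_set H'" for f
    by (auto simp: point_set_def)
  have eV: "e \<inter> verts ?G = {u, v}"
  proof -
    have "e \<inter> verts H = {u}" "e \<inter> verts H' = {v}" using eH VP uv by blast+
    then show ?thesis by (auto simp: Int_Un_distrib)
  qed
  have fV: "f \<inter> verts ?G = f \<inter> verts H" if "f \<in> edges H" for f
    using EP(1)[OF that] VP(2) disj by auto
  have fV': "f \<inter> verts ?G = f \<inter> verts H'" if "f \<in> edges H'" for f
    using EP(2)[OF that] VP(1) disj by auto
  have sub: "f \<inter> verts ?G \<subseteq> point_set H" "f \<inter> verts ?G \<noteq> {}" if "f \<in> edges H" for f
    using fV[OF that] VP plane_graphD(4)[OF H that] by auto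
  have sub': "f \<inter> verts ?G \<subseteq> point_set H'" "f \<inter> verts ?G \<noteq> {}" if "f \<in> edges H'" for f
    using fV'[OF that] VP plane_graphD(4)[OF H' that] by auto
  have e_sub: "\<not> e \<inter> verts ?G \<subseteq> point_set H" "\<not> e \<inter> verts ?G \<subseteq> point_set H'"
    unfolding eV using uv VP disj by blast+
  have ef: "e \<inter> f \<subseteq> verts ?G" if "f \<in> edges H \<union> edges H'" for f
  proof -
    have "e \<inter> f \<subseteq> e \<inter> point_set H \<union> e \<inter> point_set H'" using that EP by blast
    then show ?thesis unfolding eH using uv by auto
  qed
  show ?thesis
    unfolding plane_graph_def
  proof (intro conjI ballI impI)
    show "finite (verts ?G)" "verts ?G \<noteq> {}" "finite (edges ?G)"
      using plane_graphD(1-3)[OF H] plane_graphD(1-3)[OF H'] by auto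
  next
    fix f assume "f \<in> edges ?G"
    then consider "f = e" | "f \<in> edges H" | "f \<in> edges H'" by auto
    then show "\<exists>u v. arc_between f u v \<and> f \<inter> verts ?G = {u, v}"
    proof cases
      case 1
      then show ?thesis using e eV by blast
    next
      case 2
      then show ?thesis using plane_graphD(4)[OF H 2] fV by simp
    next
      case 3
      then show ?thesis using plane_graphD(4)[OF H' 3] fV' by simp
    qed
  next
    fix f f' assume f: "f \<in> edges ?G" "f' \<in> edges ?G" "f \<noteq> f'"
    then consider "f = e" "f' \<in> edges H \<union> edges H'" | "f' = e" "f \<in> edges H \<union> edges H'"
      | "f \<in> edges H" "f' \<in> edges H" | "f \<in> edges H'" "f' \<in> edges H'"
      | "f \<in> edges H" "f' \<in> edges H'" | "f \<in> edges H'" "f' \<in> edges H"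
      by auto
    then have "f \<inter> f' \<subseteq> verts ?G \<and> f \<inter> verts ?G \<noteq> f' \<inter> verts ?G"
    proof cases
      case 1
      then show ?thesis using ef e_sub sub sub' by (metis Un_iff)
    next
      case 2
      then show ?thesis using ef e_sub sub sub' by (metis Un_iff Int_commute)
    next
      case 3
      then show ?thesis
        using plane_graphD(5,6)[OF H 3 f(3)] fV by (simp add: le_supI1)
    next
      case 4
      then show ?thesis
        using plane_graphD(5,6)[OF H' 4 f(3)] fV' by (simp add: le_supI2)
    next
      case 5
      have "f \<inter> f' = {}" using EP 5 disj by blast
      then show ?thesis using sub[OF 5(1)] sub'[OF 5(2)] disj by blast
    next
      case 6
      have "f \<inter> f' = {}" using EP 6 disj by blast
      then show ?thesis using sub[OF 6(2)] sub'[OF 6(1)] disj by blast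
    qed
    then show "f \<inter> f' \<subseteq> verts ?G" "f \<inter> verts ?G \<noteq> f' \<inter> verts ?G" by auto
  qed
qed

lemma G_graph_exists:
  assumes k: "1 \<le> k"
  shows "\<exists>G. G_graph k G"
proof -
  define n where "n = 3 * k + 1"
  \<comment> \<open>The rotations turn \<open>a 4\<close> of the left drawing to angle 0 and
    \<open>a 2\<close> of the right one to angle \<open>pi\<close>. With centers 0 and 6 and outer
    radius 2 they become the points 2 and 4, facing each other on the real axis.\<close>
  define \<sigma> \<tau> where "\<sigma> = cis (- (2 * pi * 4 / n))" and "\<tau> = - cis (- (2 * pi * 2 / n))"
  interpret L: annulus_drawing k 0 \<sigma>
    using k by unfold_locales (auto simp: \<sigma>_def)
  interpret R: annulus_drawing k 6 \<tau>
    using k by unfold_locales (auto simp: \<tau>_def)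
  have n: "L.n = n" "R.n = n" by (simp_all add: L.n_def R.n_def n_def)
  have a4: "L.a 4 = 2" unfolding L.a_def L.polar_def n by (simp add: \<sigma>_def cis_mult)
  have a2: "R.a 2 = 4" unfolding R.a_def R.polar_def n by (simp add: \<tau>_def cis_mult)
  have V: "L.a 4 \<in> verts L.H" "R.a 2 \<in> verts R.H"
    using k H_labelledD(5)[OF L.H_labelled_H] H_labelledD(5)[OF R.H_labelled_H] by auto
  define e where "e = closed_segment (2 :: complex) 4"
  have e: "arc_between e (L.a 4) (R.a 2)"
    unfolding arc_between_def a4 a2 e_def
    by (intro exI[of _ "linepath 2 4"]) auto
  have pt: "z = of_real (Re z)" "2 \<le> Re z" "Re z \<le> 4" if "z \<in> e" for z
    using that by (auto simp: e_def closed_segment_def complex_eq_iff)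
  have eL: "z = 2" if "z \<in> e" "z \<in> cball 0 2" for z
  proof -
    have "norm z = \<bar>Re z\<bar>" using pt(1)[OF that(1)] by (metis norm_of_real real_norm_def)
    then have "Re z = 2" using that pt[OF that(1)] by auto
    then show ?thesis using pt(1)[OF that(1)] by simp
  qed
  have eR: "z = 4" if "z \<in> e" "z \<in> cball 6 2" for z
  proof -
    have "6 - z = of_real (6 - Re z)" using pt(1)[OF that(1)] by (metis of_real_diff of_real_numeral)
    then have "dist 6 z = \<bar>6 - Re z\<bar>" by (metis dist_norm norm_of_real)
    then have "Re z = 4" using that pt[OF that(1)] by auto
    then show ?thesis using pt(1)[OF that(1)] by simp
  qed
  \<comment> \<open>The centers are 6 apart, while the radii add up to 4.\<close>
  have balls: "cball 0 2 \<inter> cball (6 :: complex) 2 = {}"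
  proof (rule ccontr)
    assume "\<not> ?thesis"
    then obtain z :: complex where "dist 0 z \<le> 2" "dist 6 z \<le> 2" by auto
    then have "dist 0 (6 :: complex) \<le> 4" using dist_triangle2[of 0 6 z] by linarith
    then show False by simp
  qed
  have out: "point_set L.H \<subseteq> outer_face R.H" "point_set R.H \<subseteq> outer_face L.H"
    unfolding L.outer_face_H R.outer_face_H using L.point_set_H(2) R.point_set_H(2) balls by blast+
  have VP: "verts L.H \<subseteq> point_set L.H" "verts R.H \<subseteq> point_set R.H" by (auto simp: point_set_def)
  have disj: "point_set L.H \<inter> point_set R.H = {}"
    using L.point_set_H(2) R.point_set_H(2) balls by blast
  have ends: "L.a 4 \<in> e \<inter> point_set L.H" "R.a 2 \<in> e \<inter> point_set R.H"
    using arc_between_ends[OF e] subsetD[OF VP(1) V(1)] subsetD[OF VP(2) V(2)] by simp_all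
  have "e \<inter> point_set L.H = {L.a 4}"
    using ends(1) eL subsetD[OF L.point_set_H(2)] a4 by auto
  moreover have "e \<inter> point_set R.H = {R.a 2}"
    using ends(2) eR subsetD[OF R.point_set_H(2)] a2 by auto
  ultimately have "plane_graph \<lparr>verts = verts L.H \<union> verts R.H, edges = insert e (edges L.H \<union> edges R.H)\<rparr>"
    by (rule plane_graph_join[OF L.plane_graph_H R.plane_graph_H disj e V])
  then have "G_graph k \<lparr>verts = verts L.H \<union> verts R.H, edges = insert e (edges L.H \<union> edges R.H)\<rparr>"
    unfolding G_graph_def using L.H_labelled_H R.H_labelled_H out e
    by (intro conjI exI[of _ L.H] exI[of _ R.H] exI[of _ L.a] exI[of _ L.b] exI[of _ R.a]
        exI[of _ R.b] exI[of _ e]) simp_all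
  then show ?thesis by blast
qed

section \<open>Infinitely many pairwise non-isomorphic counterexamples\<close>

theorem mainTheorem2:
  shows
    "(\<forall>k\<ge>1. (\<exists>H. H_graph k H) \<and>
        (\<forall>H. H_graph k H \<longrightarrow>
           plane_graph H \<and> card (verts H) = 6 * k + 2 \<and>
           (\<forall>c. proper_coloring H c \<and> c ` verts H \<subseteq> {1, 2, 3, 4} \<and>
                (\<forall>F\<in>interior_faces H. unique_max_color H c F) \<longrightarrow>
                (\<exists>v\<in>face_verts H (outer_face H). c v = 4))))
     \<and> (\<forall>k\<ge>1. (\<exists>G. G_graph k G) \<and>
        (\<forall>G. G_graph k G \<longrightarrow> plane_graph G \<and> chi_fum G > 4))
     \<and> (\<forall>k\<ge>1. \<forall>l\<ge>1. \<forall>G G'. G_graph k G \<and> G_graph l G' \<and> k \<noteq> l \<longrightarrow> \<not> isomorphic_graphs G G')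
     \<and> \<not> (\<forall>G. plane_graph G \<longrightarrow> chi_fum G \<le> 4)"
proof -
  have H: "plane_graph H" "card (verts H) = 6 * k + 2"
    if "H_graph k H" for k H
    using that H_labelledD(1) H_labelled_card unfolding H_graph_def by blast+
  have color_4: "\<exists>v\<in>face_verts H (outer_face H). c v = 4"
    if H: "H_graph k H" and k: "1 \<le> k" and c: "proper_coloring H c" "c ` verts H \<subseteq> {1, 2, 3, 4}"
      "\<forall>F\<in>interior_faces H. unique_max_color H c F" for k H c
  proof -
    obtain a b where L: "H_labelled k a b H" using H unfolding H_graph_def by blast
    have "a ` {1..3 * k + 1} \<subseteq> face_verts H (outer_face H)"
      using H_labelled_outer_face[OF L k] by metis
    then show ?thesis
      using H_labelled_outer_color_4[OF L k c(1,2)] c(3) by blast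
  qed
  \<comment> \<open>The vertex counts \<open>2 * (6 * k + 2)\<close> already tell the graphs
    apart.\<close>
  have iso: "\<not> isomorphic_graphs G G'"
    if "G_graph k G" "G_graph l G'" "1 \<le> k" "1 \<le> l" "k \<noteq> l" for k l G G'
  proof
    assume "isomorphic_graphs G G'"
    then have "card (verts G) = card (verts G')"
      unfolding isomorphic_graphs_def using bij_betw_same_card by blast
    then show False
      using G_graph_chi_fum(3)[OF that(1,3)] G_graph_chi_fum(3)[OF that(2,4)] that(5) by simp
  qed
  have conjecture_false: "\<not> (\<forall>G. plane_graph G \<longrightarrow> chi_fum G \<le> 4)"
  proof
    assume A: "\<forall>G. plane_graph G \<longrightarrow> chi_fum G \<le> 4"
    obtain G where G: "G_graph 1 G" using G_graph_exists[of 1] by auto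
    then show False
      using A G_graph_chi_fum(1,2)[OF G order.refl] by (auto simp flip: not_le)
  qed
  show ?thesis
    by (intro conjI allI impI; (elim conjE)?)
      (assumption | rule H_graph_exists H color_4 G_graph_exists G_graph_chi_fum(1,2) iso
        conjecture_false)+
qed

end
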